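(* Let $k$ be a field, let $V$ be a $k$-vector space of finite dimension $n\geq 1$, and let $(x_1, \ldots, x_n)$ be a basis of $V$. Let $f=x_{i_1} \ldots x_{i_N}\in V^{\otimes N}$ be a monomial of degree $N\geq 2$, and let $R$ be the subspace of $V^{\otimes N}$ generated by $f$. Then the graded algebra $A=A(V,R)=T(V)/I(R)$ is $N$-Koszul if and only if there exists no $m$ in $\{2,\ldots , N-1\}$ such that $$f=(x_{i_1} \ldots x_{i_m})^q\, x_{i_1} \ldots x_{i_r},$$ where $N=mq+r$ is the division of $N$ by $m$ with remainder $r$, and where $i_1,\ldots ,i_m$ are not all equal.
   Context: $V$ is placed in degree $1$, $T(V)$ is the tensor algebra (tensor symbols are omitted in monomials), $I(R)$ is the two-sided ideal generated by $R\subseteq V^{\otimes N}$, and $A=A(V,R)=T(V)/I(R)$. Define $\nu_N(2i)=Ni$, $\nu_N(2i+1)=Ni+1$ for $i\in\mathbb{N}$. For $m\ge 0$ let $W_m=\bigcap_{i+N+j=m}V^{\otimes i}\otimes R\otimes V^{\otimes j}\subseteq V^{\otimes m}$ (so $W_m=V^{\otimes m}$ for $m<N$, and $W_N=R$). The Koszul complex $K(A)$ is the complex of left $A$-modules $\cdots\to K_i\xrightarrow{\delta_i}K_{i-1}\to\cdots\to K_0\to 0$ with $K_i=A\otimes W_{\nu_N(i)}$, where $\delta_i$ is the left $A$-linear map induced by the inclusion $W_{\nu_N(i)}\subseteq V^{\otimes(\nu_N(i)-\nu_N(i-1))}\otimes W_{\nu_N(i-1)}$ (followed by projecting the first tensor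 factor to $A$ and multiplying in $A$). $A$ is $N$-Koszul if the homology of $K(A)$ is $0$ in every degree $i>0$. *)

theory Defs
  imports Complex_Main "HOL-Algebra.Module" "HOL-Algebra.QuotRing" "HOL-Algebra.Elementary_Groups"
    "HOL-Algebra.Free_Abelian_Groups"
begin

section \<open>Linear algebra over a field given as a type\<close>

definition base_field :: "'k::field ring" where
  "base_field = \<lparr>carrier = UNIV, monoid.mult = (*), one = 1, ring.zero = 0, ring.add = (+)\<rparr>"

definition lin_span :: "('k::field, 't, 'm) module_scheme \<Rightarrow> 't set \<Rightarrow> 't set" where
  "lin_span M S = \<Inter>{H. submodule H base_field M \<and> S \<subseteq> H}"

text \<open>The quotient of a \<open>k\<close>-algebra by a two-sided ideal, with the induced scalar multiplication.\<close>

definition quot_algebra :: "('k, 't, 'm) module_scheme \<Rightarrow> 't set \<Rightarrow> ('k, 't set) module"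
    (infixl \<open>QuotAlg\<close> 65) where
  "A QuotAlg I = ring.extend (A Quot I)
     (module.fields (\<lambda>c X. \<Union>x\<in>X. I +>\<^bsub>A\<^esub> (c \<odot>\<^bsub>A\<^esub> x)))"

section \<open>The tensor algebra\<close>

text \<open>
  Lists form a monoid under concatenation, so \<open>'v list \<Rightarrow>\<^sub>0 'k\<close> with the convolution
  product is the free associative \<open>k\<close>-algebra on the set \<open>'v\<close>.
\<close>

instantiation list :: (type) monoid_add
begin
definition zero_list :: "'a list" where "zero_list = []"
definition plus_list :: "'a list \<Rightarrow> 'a list \<Rightarrow> 'a list" where "plus_list xs ys = xs @ ys"
instance by standard (simp_all add: zero_list_def plus_list_def)
end

definition free_algebra :: "('k::field, 'v list \<Rightarrow>\<^sub>0 'k) module" where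
  "free_algebra = \<lparr>carrier = UNIV, monoid.mult = (*), one = 1, ring.zero = 0, ring.add = (+),
     module.smult = (\<lambda>c p. Poly_Mapping.map ((*) c) p)\<rparr>"

text \<open>
  \<open>T(V)\<close> is the free algebra on the underlying set of \<open>V\<close> modulo the relations that make
  the map sending \<open>v\<close> to the one-letter word \<open>v\<close> linear. Here \<open>V\<close> is the type
  \<open>'v\<close> with scalar multiplication \<open>scale\<close>.
\<close>

definition linearity_relations ::
    "('k::field \<Rightarrow> 'v::ab_group_add \<Rightarrow> 'v) \<Rightarrow> ('v list \<Rightarrow>\<^sub>0 'k) set" where
  "linearity_relations scale =
     {Poly_Mapping.single [v + w] 1 - (Poly_Mapping.single [v] 1 + Poly_Mapping.single [w] 1)
       | v w. True} \<union>
     {Poly_Mapping.single [scale c v] 1 - Poly_Mapping.single [v] c | c v. True}"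

definition tensor_algebra ::
    "('k::field \<Rightarrow> 'v::ab_group_add \<Rightarrow> 'v) \<Rightarrow> ('k, ('v list \<Rightarrow>\<^sub>0 'k) set) module" where
  "tensor_algebra scale =
     free_algebra QuotAlg (Idl\<^bsub>free_algebra\<^esub> (linearity_relations scale))"

text \<open>\<open>pure_tensor scale [v\<^sub>1, \<dots>, v\<^sub>m]\<close> is \<open>v\<^sub>1 \<otimes> \<dots> \<otimes> v\<^sub>m\<close>.\<close>

definition pure_tensor ::
    "('k::field \<Rightarrow> 'v::ab_group_add \<Rightarrow> 'v) \<Rightarrow> 'v list \<Rightarrow> ('v list \<Rightarrow>\<^sub>0 'k) set" where
  "pure_tensor scale vs =
     (Idl\<^bsub>free_algebra\<^esub> (linearity_relations scale)) +>\<^bsub>free_algebra\<^esub> Poly_Mapping.single vs 1"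

text \<open>The monomial \<open>x\<^bsub>i\<^sub>1\<^esub> \<dots> x\<^bsub>i\<^sub>m\<^esub>\<close> in \<open>T(V)\<close>.\<close>

definition monomial ::
    "('k::field \<Rightarrow> 'v::ab_group_add \<Rightarrow> 'v) \<Rightarrow> (nat \<Rightarrow> 'v) \<Rightarrow> (nat \<Rightarrow> nat) \<Rightarrow> nat \<Rightarrow> ('v list \<Rightarrow>\<^sub>0 'k) set" where
  "monomial scale x i m = pure_tensor scale (map (\<lambda>j. x (i j)) [1..<m + 1])"

definition tensor_power ::
    "('k::field \<Rightarrow> 'v::ab_group_add \<Rightarrow> 'v) \<Rightarrow> nat \<Rightarrow> ('v list \<Rightarrow>\<^sub>0 'k) set set" where
  "tensor_power scale m = lin_span (tensor_algebra scale) {pure_tensor scale vs | vs. length vs = m}"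

section \<open>The algebra \<open>A(V,R)\<close> and the spaces \<open>W\<^sub>m\<close>\<close>

definition relation_algebra ::
    "('k::field \<Rightarrow> 'v::ab_group_add \<Rightarrow> 'v) \<Rightarrow> ('v list \<Rightarrow>\<^sub>0 'k) set set
      \<Rightarrow> ('k, ('v list \<Rightarrow>\<^sub>0 'k) set set) module" where
  "relation_algebra scale R = tensor_algebra scale QuotAlg (Idl\<^bsub>tensor_algebra scale\<^esub> R)"

definition algebra_class ::
    "('k::field \<Rightarrow> 'v::ab_group_add \<Rightarrow> 'v) \<Rightarrow> ('v list \<Rightarrow>\<^sub>0 'k) set set
      \<Rightarrow> ('v list \<Rightarrow>\<^sub>0 'k) set \<Rightarrow> ('v list \<Rightarrow>\<^sub>0 'k) set set" where
  "algebra_class scale R t = (Idl\<^bsub>tensor_algebra scale\<^esub> R) +>\<^bsub>tensor_algebra scale\<^esub> t"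

text \<open>
  Tensor products of subspaces of tensor powers of \<open>V\<close> are formed inside \<open>T(V)\<close>, as spans of
  products. The intersection with \<open>V\<^sup>\<otimes>\<^sup>m\<close> matters only for \<open>m < N\<close>, where the
  index set is empty.
\<close>

definition koszul_space ::
    "('k::field \<Rightarrow> 'v::ab_group_add \<Rightarrow> 'v) \<Rightarrow> nat \<Rightarrow> ('v list \<Rightarrow>\<^sub>0 'k) set set
      \<Rightarrow> nat \<Rightarrow> ('v list \<Rightarrow>\<^sub>0 'k) set set" where
  "koszul_space scale N R m = tensor_power scale m \<inter>
     \<Inter>{lin_span (tensor_algebra scale)
          (tensor_power scale i <#>\<^bsub>tensor_algebra scale\<^esub> R <#>\<^bsub>tensor_algebra scale\<^esub> tensor_power scale j)
        | i j. i + N + j = m}"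

section \<open>Tensor products over \<open>k\<close>\<close>

text \<open>
  \<open>U \<otimes>\<^sub>k W\<close>, written multiplicatively as an abelian group: the free abelian group on
  \<open>U \<times> W\<close> modulo biadditivity and \<open>k\<close>-balancedness.
\<close>

definition tensor_relations ::
    "('k, 'u, 'm) module_scheme \<Rightarrow> ('k, 'w, 'n) module_scheme \<Rightarrow> (('u \<times> 'w) \<Rightarrow>\<^sub>0 int) set" where
  "tensor_relations U W =
     {frag_of (u \<oplus>\<^bsub>U\<^esub> u', w) - (frag_of (u, w) + frag_of (u', w))
       | u u' w. u \<in> carrier U \<and> u' \<in> carrier U \<and> w \<in> carrier W} \<union>
     {frag_of (u, w \<oplus>\<^bsub>W\<^esub> w') - (frag_of (u, w) + frag_of (u, w'))
       | u w w'. u \<in> carrier U \<and> w \<in> carrier W \<and> w' \<in> carrier W} \<union>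
     {frag_of (c \<odot>\<^bsub>U\<^esub> u, w) - frag_of (u, c \<odot>\<^bsub>W\<^esub> w)
       | c u w. u \<in> carrier U \<and> w \<in> carrier W}"

definition tensor_kernel ::
    "('k, 'u, 'm) module_scheme \<Rightarrow> ('k, 'w, 'n) module_scheme \<Rightarrow> (('u \<times> 'w) \<Rightarrow>\<^sub>0 int) set" where
  "tensor_kernel U W =
     generate (free_Abelian_group (carrier U \<times> carrier W)) (tensor_relations U W)"

definition tensor_product ::
    "('k, 'u, 'm) module_scheme \<Rightarrow> ('k, 'w, 'n) module_scheme \<Rightarrow> (('u \<times> 'w) \<Rightarrow>\<^sub>0 int) set monoid" where
  "tensor_product U W =
     free_Abelian_group (carrier U \<times> carrier W) Mod tensor_kernel U W"

definition tensor_elt ::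
    "('k, 'u, 'm) module_scheme \<Rightarrow> ('k, 'w, 'n) module_scheme \<Rightarrow> 'u \<Rightarrow> 'w \<Rightarrow> (('u \<times> 'w) \<Rightarrow>\<^sub>0 int) set" where
  "tensor_elt U W u w =
     tensor_kernel U W #>\<^bsub>free_Abelian_group (carrier U \<times> carrier W)\<^esub> frag_of (u, w)"

section \<open>The Koszul complex\<close>

definition jump :: "nat \<Rightarrow> nat \<Rightarrow> nat" where
  "jump N i = (if even i then N * (i div 2) else N * (i div 2) + 1)"

definition koszul_coeff ::
    "('k::field \<Rightarrow> 'v::ab_group_add \<Rightarrow> 'v) \<Rightarrow> nat \<Rightarrow> ('v list \<Rightarrow>\<^sub>0 'k) set set
      \<Rightarrow> nat \<Rightarrow> ('k, ('v list \<Rightarrow>\<^sub>0 'k) set) module" where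
  "koszul_coeff scale N R i = (tensor_algebra scale)\<lparr>carrier := koszul_space scale N R (jump N i)\<rparr>"

definition koszul_module ::
    "('k::field \<Rightarrow> 'v::ab_group_add \<Rightarrow> 'v) \<Rightarrow> nat \<Rightarrow> ('v list \<Rightarrow>\<^sub>0 'k) set set \<Rightarrow> nat
      \<Rightarrow> ((('v list \<Rightarrow>\<^sub>0 'k) set set \<times> ('v list \<Rightarrow>\<^sub>0 'k) set) \<Rightarrow>\<^sub>0 int) set monoid" where
  "koszul_module scale N R i =
     tensor_product (relation_algebra scale R) (koszul_coeff scale N R i)"

text \<open>
  \<open>\<delta>\<^sub>i\<close> for \<open>i \<ge> 1\<close>: the additive map sending \<open>a \<otimes> w\<close>, where
  \<open>w = \<Sum>\<^sub>j u\<^sub>j w\<^sub>j\<close> with \<open>u\<^sub>j\<close> in the tensor power of \<open>V\<close> of degree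
  \<open>\<nu>\<^sub>N(i) - \<nu>\<^sub>N(i-1)\<close> and \<open>w\<^sub>j\<close> in \<open>W\<close> of degree \<open>\<nu>\<^sub>N(i-1)\<close>,
  to the sum of the \<open>a [u\<^sub>j] \<otimes> w\<^sub>j\<close>. Left \<open>A\<close>-linearity is built into this formula,
  since \<open>a\<close> is arbitrary; only the underlying abelian groups of the modules are recorded, which is
  all that the homology needs. Extensionality only pins down the values outside the carrier.
\<close>

definition koszul_diff ::
    "('k::field \<Rightarrow> 'v::ab_group_add \<Rightarrow> 'v) \<Rightarrow> nat \<Rightarrow> ('v list \<Rightarrow>\<^sub>0 'k) set set \<Rightarrow> nat
      \<Rightarrow> ((('v list \<Rightarrow>\<^sub>0 'k) set set \<times> ('v list \<Rightarrow>\<^sub>0 'k) set) \<Rightarrow>\<^sub>0 int) set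
      \<Rightarrow> ((('v list \<Rightarrow>\<^sub>0 'k) set set \<times> ('v list \<Rightarrow>\<^sub>0 'k) set) \<Rightarrow>\<^sub>0 int) set" where
  "koszul_diff scale N R i =
     (let T = tensor_algebra scale; A = relation_algebra scale R;
          K = koszul_module scale N R i; K' = koszul_module scale N R (i - 1);
          W = koszul_coeff scale N R i; W' = koszul_coeff scale N R (i - 1)
      in THE d. d \<in> hom K K' \<inter> extensional (carrier K) \<and>
           (\<forall>a \<in> carrier A. \<forall>(l::nat) u w.
              u \<in> {..<l} \<rightarrow> tensor_power scale (jump N i - jump N (i - 1)) \<longrightarrow>
              w \<in> {..<l} \<rightarrow> carrier W' \<longrightarrow>
              (\<Oplus>\<^bsub>T\<^esub>j\<in>{..<l}. u j \<otimes>\<^bsub>T\<^esub> w j) \<in> carrier W \<longrightarrow>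
              d (tensor_elt A W a (\<Oplus>\<^bsub>T\<^esub>j\<in>{..<l}. u j \<otimes>\<^bsub>T\<^esub> w j)) =
                (\<Otimes>\<^bsub>K'\<^esub>j\<in>{..<l}. tensor_elt A W' (a \<otimes>\<^bsub>A\<^esub> algebra_class scale R (u j)) (w j))))"

definition koszul_homology ::
    "('k::field \<Rightarrow> 'v::ab_group_add \<Rightarrow> 'v) \<Rightarrow> nat \<Rightarrow> ('v list \<Rightarrow>\<^sub>0 'k) set set \<Rightarrow> nat
      \<Rightarrow> ((('v list \<Rightarrow>\<^sub>0 'k) set set \<times> ('v list \<Rightarrow>\<^sub>0 'k) set) \<Rightarrow>\<^sub>0 int) set set monoid" where
  "koszul_homology scale N R i =
     (koszul_module scale N R i)
       \<lparr>carrier := kernel (koszul_module scale N R i) (koszul_module scale N R (i - 1))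
                    (koszul_diff scale N R i)\<rparr>
     Mod (koszul_diff scale N R (i + 1) ` carrier (koszul_module scale N R (i + 1)))"

definition N_koszul ::
    "('k::field \<Rightarrow> 'v::ab_group_add \<Rightarrow> 'v) \<Rightarrow> nat \<Rightarrow> ('v list \<Rightarrow>\<^sub>0 'k) set set \<Rightarrow> bool" where
  "N_koszul scale N R \<longleftrightarrow> (\<forall>i>0. trivial_group (koszul_homology scale N R i))"

end

theory Submission
  imports Defs "HOL-Library.Sublist"
begin

text \<open>Choose the given basis \<open>B\<close> of \<open>V\<close>; everything is then governed by words over \<open>B\<close>. Write
\<open>f\<close> also for the word of length \<open>N\<close> that spells the relation.

The words form a basis of \<open>T(V)\<close> (\<open>tclass_inject\<close>, \<open>carrier_T\<close>). The ideal generated by \<open>f\<close> is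
spanned by the words with a factor \<open>f\<close>, so the words without such a factor, the normal words, give a
basis of \<open>A\<close> (\<open>rel_ideal_eq\<close>, \<open>aclass_eq_iff\<close>). The space \<open>W\<^sub>m\<close> is spanned by the words of length
\<open>m\<close> all of whose factors of length \<open>N\<close> are equal to \<open>f\<close> (\<open>koszul_space_eq\<close>). Hence \<open>K\<^sub>i\<close> has the basis
\<open>w \<otimes> s\<close> with \<open>w\<close> normal and \<open>s\<close> a word of \<open>W\<close> in degree \<open>\<nu>\<^sub>N(i)\<close>
(\<open>carrier_K\<close>, \<open>kclass_eq_iff\<close>), and the differential sends \<open>w \<otimes> u s'\<close> to \<open>w u \<otimes> s'\<close> if
\<open>w u\<close> is normal and to \<open>0\<close> otherwise (\<open>dmap_kclass\<close>, \<open>koszul_diff_dmap\<close>).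

A basis element of \<open>K\<^sub>i\<close> is therefore mapped to a basis element or to \<open>0\<close>, and distinct basis
elements have distinct nonzero images, because the words \<open>u\<close> that are moved all have the same length. So the
kernel is spanned by the \<open>w \<otimes> u s'\<close> for which \<open>w u\<close> has a factor \<open>f\<close>, the image by those
\<open>w \<otimes> s\<close> for which a suffix \<open>v\<close> of \<open>w\<close> makes \<open>v s\<close> a word of \<open>W\<close> in the next degree, and
exactness at \<open>K\<^sub>i\<close> becomes a condition on words (\<open>exact_on_words\<close>, \<open>trivial_homology_iff\<close>).

In degree \<open>1\<close> the condition always holds: if \<open>w\<close> is normal and \<open>w b\<close> is not, then \<open>w b\<close> ends with \<open>f\<close>.
If \<open>f\<close> is a power of a letter \<open>b\<close>, then every \<open>W\<close> from degree \<open>N\<close> on is spanned by a power of \<open>b\<close>, and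
the condition holds in every degree. Otherwise a word of length \<open>N + 1\<close> cannot have both of its long
factors equal to \<open>f\<close>, so the complex stops at \<open>K\<^sub>2 = A \<otimes> f\<close>, and what remains is the injectivity of
right multiplication by \<open>f\<close> without its last letter. A normal word \<open>w\<close> in the kernel of this map is one
that completes \<open>f\<close> across the border between the two factors, so such a \<open>w\<close> exists if and only if a
proper nonempty suffix of \<open>f\<close> is also a prefix of \<open>f\<close> (\<open>exact_on_words_2_iff\<close>). A border of length
\<open>p\<close> is the same as a period \<open>m = N - p\<close>, and a period is a decomposition
\<open>f = u\<^sup>q u'\<close> with \<open>u\<close> of length \<open>m\<close> and \<open>u'\<close> a prefix of \<open>u\<close> (\<open>border_iff_period\<close>).\<close>

section \<open>Polynomials in non-commuting letters\<close>

lemma poly_mapping_sum_singles: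
  fixes p :: "'a \<Rightarrow>\<^sub>0 'b::comm_monoid_add"
  shows "p = (\<Sum>k\<in>Poly_Mapping.keys p. Poly_Mapping.single k (Poly_Mapping.lookup p k))"
proof (rule poly_mapping_eqI)
  fix w
  have "Poly_Mapping.lookup (\<Sum>k\<in>Poly_Mapping.keys p. Poly_Mapping.single k (Poly_Mapping.lookup p k)) w =
      (\<Sum>k\<in>Poly_Mapping.keys p. if k = w then Poly_Mapping.lookup p w else 0)"
    unfolding lookup_sum by (intro sum.cong) (auto simp: lookup_single when_def)
  also have "\<dots> = Poly_Mapping.lookup p w"
    by (simp add: in_keys_iff)
  finally show "Poly_Mapping.lookup p w =
      Poly_Mapping.lookup (\<Sum>k\<in>Poly_Mapping.keys p. Poly_Mapping.single k (Poly_Mapping.lookup p k)) w" ..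
qed

text \<open>Additive statements about polynomials are proved for monomials; the set \<open>Z\<close> keeps the support of
  the monomials under control.\<close>

lemma poly_mapping_single_induct [consumes 1, case_names zero single add]:
  fixes p :: "'a \<Rightarrow>\<^sub>0 'b::comm_monoid_add"
  assumes "Poly_Mapping.keys p \<subseteq> Z"
    and "P 0"
    and "\<And>k c. k \<in> Z \<Longrightarrow> P (Poly_Mapping.single k c)"
    and "\<And>p q. P p \<Longrightarrow> P q \<Longrightarrow> P (p + q)"
  shows "P p"
proof -
  have "P (\<Sum>k\<in>F. Poly_Mapping.single k (Poly_Mapping.lookup p k))"
    if "finite F" "F \<subseteq> Poly_Mapping.keys p" for F
    using that
  proof (induction F rule: finite_induct)
    case (insert k F)
    then show ?case using assms by auto
  qed (simp add: assms(2))
  from this[of "Poly_Mapping.keys p"] poly_mapping_sum_singles[of p] show ?thesis by simp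
qed

lemma keys_sum_subset:
  fixes b :: "'j \<Rightarrow> 'a \<Rightarrow>\<^sub>0 'b::comm_monoid_add"
  shows "(\<And>j. j \<in> J \<Longrightarrow> Poly_Mapping.keys (b j) \<subseteq> Z) \<Longrightarrow> Poly_Mapping.keys (sum b J) \<subseteq> Z"
proof (induction J rule: infinite_finite_induct)
  case (insert j J)
  then show ?case using keys_add[of "b j" "sum b J"] by auto
qed auto

lemma keys_diff_subset:
  fixes p q :: "'a \<Rightarrow>\<^sub>0 'b::ab_group_add"
  shows "Poly_Mapping.keys (p - q) \<subseteq> Poly_Mapping.keys p \<union> Poly_Mapping.keys q"
  by (auto simp: in_keys_iff lookup_minus)

lemma single_mult_single:
  "Poly_Mapping.single u a * Poly_Mapping.single v b = Poly_Mapping.single (u @ v) (a * b :: 'k::semiring_0)"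
  by (simp add: mult_single plus_list_def)

lemma keys_mult_words:
  "Poly_Mapping.keys (p * q) \<subseteq> {u @ v | u v. u \<in> Poly_Mapping.keys p \<and> v \<in> Poly_Mapping.keys q}"
  using keys_mult[of p q] by (auto simp: plus_list_def)

text \<open>Since words of length \<open>length v\<close> can be split off in only one way, the coefficients of a
  product with a homogeneous factor involve no sum.\<close>

lemma lookup_mult_homogeneous_right:
  fixes p q :: "'a list \<Rightarrow>\<^sub>0 'k::semiring_0"
  assumes "Poly_Mapping.keys q \<subseteq> {v. length v = e}" "length v = e"
  shows "Poly_Mapping.lookup (p * q) (u @ v) = Poly_Mapping.lookup p u * Poly_Mapping.lookup q v"
  using assms(1)
proof (induction q rule: poly_mapping_single_induct)
  case (single v' b)
  show ?case using subset_UNIV[of "Poly_Mapping.keys p"]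
  proof (induction p rule: poly_mapping_single_induct)
    case (single u' a)
    then show ?case using assms(2) \<open>v' \<in> _\<close> 
      by (auto simp: single_mult_single lookup_single when_def)
  qed (auto simp: algebra_simps lookup_add)
qed (auto simp: algebra_simps lookup_add)

lemma lookup_mult_homogeneous_left:
  fixes p q :: "'a list \<Rightarrow>\<^sub>0 'k::semiring_0"
  assumes "Poly_Mapping.keys p \<subseteq> {u. length u = e}" "length u = e"
  shows "Poly_Mapping.lookup (p * q) (u @ v) = Poly_Mapping.lookup p u * Poly_Mapping.lookup q v"
  using assms(1)
proof (induction p rule: poly_mapping_single_induct)
  case (single u' a)
  show ?case using subset_UNIV[of "Poly_Mapping.keys q"]
  proof (induction q rule: poly_mapping_single_induct)
    case (single v' b)
    then show ?case using assms(2) \<open>u' \<in> _\<close> 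
      by (auto simp: single_mult_single lookup_single when_def)
  qed (auto simp: algebra_simps lookup_add)
qed (auto simp: algebra_simps lookup_add)

lemma lookup_mult_word_not_suffix:
  fixes p :: "'a list \<Rightarrow>\<^sub>0 'k::semiring_0"
  assumes "\<not> suffix u w"
  shows "Poly_Mapping.lookup (p * Poly_Mapping.single u c) w = 0"
proof -
  have "w \<notin> Poly_Mapping.keys (p * Poly_Mapping.single u c)"
    using assms keys_mult_words[of p "Poly_Mapping.single u c"]
    by (auto simp: suffix_def split: if_splits)
  then show ?thesis by (simp add: in_keys_iff)
qed

lemma lookup_mult_word:
  fixes p :: "'a list \<Rightarrow>\<^sub>0 'k::semiring_1"
  shows "Poly_Mapping.lookup (p * Poly_Mapping.single u 1) (w @ u) = Poly_Mapping.lookup p w"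
  by (subst lookup_mult_homogeneous_right[where e = "length u"]) auto

definition right_quotient :: "'a list \<Rightarrow> ('a list \<Rightarrow>\<^sub>0 'k::zero) \<Rightarrow> ('a list \<Rightarrow>\<^sub>0 'k)" where
  "right_quotient u p = Poly_Mapping.map_key (\<lambda>w. w @ u) p"

lemma lookup_right_quotient:
  "Poly_Mapping.lookup (right_quotient u p) w = Poly_Mapping.lookup p (w @ u)"
  by (simp add: right_quotient_def map_key.rep_eq inj_def)

section \<open>Quotients of algebras by two-sided ideals\<close>

text \<open>The last three assumptions make the scalar multiplication of \<open>A\<close> descend to the cosets of \<open>I\<close>.\<close>

locale algebra_ideal = ideal I A
  for I :: "'t set" and A :: "('k::field, 't, 'm) module_scheme" (structure) +
  assumes smult_closed: "a \<in> carrier A \<Longrightarrow> c \<odot> a \<in> carrier A"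
    and smult_ideal: "a \<in> I \<Longrightarrow> c \<odot> a \<in> I"
    and smult_add: "a \<in> carrier A \<Longrightarrow> b \<in> carrier A \<Longrightarrow> c \<odot> (a \<oplus> b) = c \<odot> a \<oplus> c \<odot> b"
begin

lemma carrier_QuotAlg: "carrier (A QuotAlg I) = (\<lambda>a. I +> a) ` carrier A"
  by (auto simp: quot_algebra_def ring.defs FactRing_simps)

lemma one_QuotAlg: "\<one>\<^bsub>A QuotAlg I\<^esub> = I +> \<one>"
  by (simp add: quot_algebra_def ring.defs FactRing_simps)

lemma zero_QuotAlg: "\<zero>\<^bsub>A QuotAlg I\<^esub> = I +> \<zero>"
  by (simp add: quot_algebra_def ring.defs FactRing_simps a_coset_add_zero a_subset)

lemma add_QuotAlg:
  "a \<in> carrier A \<Longrightarrow> b \<in> carrier A \<Longrightarrow> (I +> a) \<oplus>\<^bsub>A QuotAlg I\<^esub> (I +> b) = I +> (a \<oplus> b)"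
  by (simp add: quot_algebra_def ring.defs FactRing_simps a_rcos_sum)

lemma mult_QuotAlg:
  "a \<in> carrier A \<Longrightarrow> b \<in> carrier A \<Longrightarrow> (I +> a) \<otimes>\<^bsub>A QuotAlg I\<^esub> (I +> b) = I +> (a \<otimes> b)"
  by (simp add: quot_algebra_def ring.defs FactRing_simps rcoset_mult_add)

lemma smult_QuotAlg:
  assumes a: "a \<in> carrier A"
  shows "c \<odot>\<^bsub>A QuotAlg I\<^esub> (I +> a) = I +> (c \<odot> a)"
proof -
  have "I +> (c \<odot> y) = I +> (c \<odot> a)" if y: "y \<in> I +> a" for y
  proof -
    obtain h where h: "h \<in> I" "y = h \<oplus> a"
      using y by (auto simp: a_r_coset_def r_coset_def)
    then have "c \<odot> y = c \<odot> h \<oplus> c \<odot> a"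
      using a by (simp add: smult_add)
    moreover have "I +> (c \<odot> h \<oplus> c \<odot> a) = I +> (c \<odot> a)"
      using h a smult_ideal[OF h(1)] smult_closed[OF a]
      by (metis a_coset_join2 a_rcos_sum a_rcos_zero a_Hcarr a_subgroup zero_closed l_zero a_coset_add_zero a_subset)
    ultimately show ?thesis by simp
  qed
  moreover have "a \<in> I +> a" using a by (rule a_rcos_self)
  ultimately have "(\<Union>y\<in>I +> a. I +> (c \<odot> y)) = I +> (c \<odot> a)"
    by blast
  then show ?thesis
    by (simp add: quot_algebra_def ring.defs module.defs)
qed

lemma coset_eq_iff:
  "a \<in> carrier A \<Longrightarrow> b \<in> carrier A \<Longrightarrow> I +> a = I +> b \<longleftrightarrow> a \<ominus> b \<in> I"
  using quotient_eq_iff_same_a_r_cos[OF ideal_axioms] by blast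

lemma ring_QuotAlg: "ring (A QuotAlg I)"
proof (rule ringI)
  show "abelian_group (A QuotAlg I)"
  proof (rule abelian_groupI)
    fix X assume "X \<in> carrier (A QuotAlg I)"
    then obtain a where "a \<in> carrier A" "X = I +> a" by (auto simp: carrier_QuotAlg)
    then show "\<exists>Y\<in>carrier (A QuotAlg I). Y \<oplus>\<^bsub>A QuotAlg I\<^esub> X = \<zero>\<^bsub>A QuotAlg I\<^esub>"
      by (intro bexI[of _ "I +> (\<ominus> a)"])
         (auto simp: carrier_QuotAlg zero_QuotAlg add_QuotAlg l_neg)
  next
    fix X Y assume "X \<in> carrier (A QuotAlg I)" "Y \<in> carrier (A QuotAlg I)"
    then obtain a b where "a \<in> carrier A" "X = I +> a" "b \<in> carrier A" "Y = I +> b"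
      by (auto simp: carrier_QuotAlg)
    then show "X \<oplus>\<^bsub>A QuotAlg I\<^esub> Y = Y \<oplus>\<^bsub>A QuotAlg I\<^esub> X"
      by (simp add: add_QuotAlg a_comm[of a b])
  qed (auto simp: carrier_QuotAlg zero_QuotAlg add_QuotAlg a_assoc)
  show "Group.monoid (A QuotAlg I)"
    by (rule monoidI) (auto simp: carrier_QuotAlg one_QuotAlg mult_QuotAlg m_assoc)
qed (auto simp: carrier_QuotAlg add_QuotAlg mult_QuotAlg l_distr r_distr)

end

section \<open>Tensor products as quotients of free abelian groups\<close>

locale tensor_pair =
  fixes U :: "('k, 'u, 'm) module_scheme" and W :: "('k, 'w, 'n) module_scheme"
  assumes add_U: "u \<in> carrier U \<Longrightarrow> u' \<in> carrier U \<Longrightarrow> u \<oplus>\<^bsub>U\<^esub> u' \<in> carrier U"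
    and smult_U: "u \<in> carrier U \<Longrightarrow> c \<odot>\<^bsub>U\<^esub> u \<in> carrier U"
    and add_W: "w \<in> carrier W \<Longrightarrow> w' \<in> carrier W \<Longrightarrow> w \<oplus>\<^bsub>W\<^esub> w' \<in> carrier W"
    and smult_W: "w \<in> carrier W \<Longrightarrow> c \<odot>\<^bsub>W\<^esub> w \<in> carrier W"
begin

abbreviation F where "F \<equiv> free_Abelian_group (carrier U \<times> carrier W)"
abbreviation TK where "TK \<equiv> tensor_kernel U W"

lemma tensor_relations_subset: "tensor_relations U W \<subseteq> carrier F"
proof -
  have keys: "Poly_Mapping.keys (frag_of x - (frag_of y + frag_of z)) \<subseteq> {x, y, z}"
    "Poly_Mapping.keys (frag_of x - frag_of y) \<subseteq> {x, y}" for x y z :: "'u \<times> 'w"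
    using keys_diff[of "frag_of x" "frag_of y + frag_of z"] keys_add[of "frag_of y" "frag_of z"]
      keys_diff[of "frag_of x" "frag_of y"]
    by auto
  show ?thesis
    unfolding tensor_relations_def
    by (auto dest!: subsetD[OF keys(1)] subsetD[OF keys(2)] intro: add_U smult_U add_W smult_W)
qed

lemma subgroup_TK: "subgroup TK F"
  unfolding tensor_kernel_def
  by (rule group.generate_is_subgroup[OF group_free_Abelian_group tensor_relations_subset])

lemma TK_closed:
  shows TK_zero: "0 \<in> TK"
    and TK_add: "z \<in> TK \<Longrightarrow> z' \<in> TK \<Longrightarrow> z + z' \<in> TK"
    and TK_minus: "z \<in> TK \<Longrightarrow> - z \<in> TK"
proof -
  interpret subgroup TK F by (rule subgroup_TK)
  show "0 \<in> TK" using one_closed by simp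
  show "z \<in> TK \<Longrightarrow> z' \<in> TK \<Longrightarrow> z + z' \<in> TK" using m_closed by simp
  assume "z \<in> TK"
  then show "- z \<in> TK"
    using subgroup.m_inv_closed[OF subgroup_TK] mem_carrier
    by (metis inv_free_Abelian_group carrier_free_Abelian_group_iff)
qed

lemma TK_diff: "z \<in> TK \<Longrightarrow> z' \<in> TK \<Longrightarrow> z - z' \<in> TK"
  using TK_add[OF _ TK_minus] by fastforce

lemma TK_sum: "(\<And>j. j \<in> J \<Longrightarrow> z j \<in> TK) \<Longrightarrow> sum z J \<in> TK"
  by (induction J rule: infinite_finite_induct) (auto simp: TK_zero TK_add)

lemma TK_relations:
  shows TK_add_left: "u \<in> carrier U \<Longrightarrow> u' \<in> carrier U \<Longrightarrow> w \<in> carrier W \<Longrightarrow>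
      frag_of (u \<oplus>\<^bsub>U\<^esub> u', w) - (frag_of (u, w) + frag_of (u', w)) \<in> TK"
    and TK_add_right: "u \<in> carrier U \<Longrightarrow> w \<in> carrier W \<Longrightarrow> w' \<in> carrier W \<Longrightarrow>
      frag_of (u, w \<oplus>\<^bsub>W\<^esub> w') - (frag_of (u, w) + frag_of (u, w')) \<in> TK"
    and TK_smult: "u \<in> carrier U \<Longrightarrow> w \<in> carrier W \<Longrightarrow>
      frag_of (c \<odot>\<^bsub>U\<^esub> u, w) - frag_of (u, c \<odot>\<^bsub>W\<^esub> w) \<in> TK"
  unfolding tensor_kernel_def tensor_relations_def by (rule generate.incl, blast)+

text \<open>The universal property of the tensor product, for functionals: a biadditive balanced map extends additively
  to the free abelian group, and the extension kills the relations and hence the subgroup that they generate.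
  This is the only way in which elements of a tensor product are shown to be different.\<close>

lemma tensor_functional:
  fixes G :: "'u \<times> 'w \<Rightarrow> 'c::ring_1"
  assumes "\<And>u u' w. u \<in> carrier U \<Longrightarrow> u' \<in> carrier U \<Longrightarrow> w \<in> carrier W \<Longrightarrow>
      G (u \<oplus>\<^bsub>U\<^esub> u', w) = G (u, w) + G (u', w)"
    and "\<And>u w w'. u \<in> carrier U \<Longrightarrow> w \<in> carrier W \<Longrightarrow> w' \<in> carrier W \<Longrightarrow>
      G (u, w \<oplus>\<^bsub>W\<^esub> w') = G (u, w) + G (u, w')"
    and "\<And>c u w. u \<in> carrier U \<Longrightarrow> w \<in> carrier W \<Longrightarrow> G (c \<odot>\<^bsub>U\<^esub> u, w) = G (u, c \<odot>\<^bsub>W\<^esub> w)"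
  obtains E :: "(('u \<times> 'w) \<Rightarrow>\<^sub>0 int) \<Rightarrow> 'c"
  where "\<And>z z'. E (z + z') = E z + E z'" "\<And>x. E (frag_of x) = G x" "\<And>z. z \<in> TK \<Longrightarrow> E z = 0"
proof
  define E where "E z = (\<Sum>x\<in>Poly_Mapping.keys z. of_int (Poly_Mapping.lookup z x) * G x)" for z
  show add: "E (z + z') = E z + E z'" for z z'
    unfolding E_def by (rule setsum_keys_plus_distrib) (auto simp: algebra_simps)
  show of: "E (frag_of x) = G x" for x by (simp add: E_def)
  have zero: "E 0 = 0" by (simp add: E_def)
  have minus: "E (- z) = - E z" for z using add[of z "- z"] zero by (simp add: eq_neg_iff_add_eq_0 add.commute)
  have diff: "E (z - z') = E z - E z'" for z z' using add[of z "- z'"] minus by simp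
  have rel: "E z = 0" if "z \<in> tensor_relations U W" for z
    using that assms unfolding tensor_relations_def by (auto simp: diff add of)
  show "E z = 0" if "z \<in> TK" for z
    using that unfolding tensor_kernel_def
  proof (induction rule: generate.induct)
    case (inv h)
    then have "h \<in> carrier F" using tensor_relations_subset by blast
    with inv show ?case by (simp add: minus rel)
  qed (simp_all add: zero rel add)
qed

definition tensor_class :: "(('u \<times> 'w) \<Rightarrow>\<^sub>0 int) \<Rightarrow> (('u \<times> 'w) \<Rightarrow>\<^sub>0 int) set" where
  "tensor_class z = TK #>\<^bsub>F\<^esub> z"

lemma tensor_elt_eq: "tensor_elt U W u w = tensor_class (frag_of (u, w))"
  by (simp add: tensor_elt_def tensor_class_def)

lemma tensor_class_eq_iff: "tensor_class z = tensor_class z' \<longleftrightarrow> z - z' \<in> TK"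
proof
  assume "tensor_class z = tensor_class z'"
  moreover have "z \<in> tensor_class z"
    using TK_zero by (force simp: tensor_class_def r_coset_def)
  ultimately obtain h where "h \<in> TK" "z = h + z'" by (auto simp: tensor_class_def r_coset_def)
  then show "z - z' \<in> TK" by simp
next
  assume *: "z - z' \<in> TK"
  have "\<exists>h'\<in>TK. h + z = h' + z'" if "h \<in> TK" for h
    using TK_add[OF that *] by (intro bexI[of _ "h + (z - z')"]) auto
  moreover have "\<exists>h'\<in>TK. h + z' = h' + z" if "h \<in> TK" for h
    using TK_diff[OF that *] by (intro bexI[of _ "h - (z - z')"]) auto
  ultimately show "tensor_class z = tensor_class z'"
    by (auto simp: tensor_class_def r_coset_def)
qed

lemma comm_group_tensor_product: "comm_group (tensor_product U W)"
  unfolding tensor_product_def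
  by (rule comm_group.abelian_FactGroup[OF abelian_free_Abelian_group subgroup_TK])

lemma carrier_tensor_product:
  "carrier (tensor_product U W) = tensor_class ` {z. Poly_Mapping.keys z \<subseteq> carrier U \<times> carrier W}"
  by (auto simp: tensor_product_def FactGroup_def RCOSETS_def tensor_class_def)

lemma one_tensor_product: "\<one>\<^bsub>tensor_product U W\<^esub> = tensor_class 0"
  by (auto simp: tensor_product_def FactGroup_def tensor_class_def r_coset_def)

lemma mult_tensor_product:
  assumes "Poly_Mapping.keys z \<subseteq> carrier U \<times> carrier W" "Poly_Mapping.keys z' \<subseteq> carrier U \<times> carrier W"
  shows "tensor_class z \<otimes>\<^bsub>tensor_product U W\<^esub> tensor_class z' = tensor_class (z + z')"
proof -
  have "TK \<lhd> F"
    using comm_group.normal_iff_subgroup[OF abelian_free_Abelian_group] subgroup_TK by blast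
  from normal.rcos_sum[OF this] show ?thesis
    using assms by (simp add: tensor_product_def tensor_class_def)
qed

text \<open>For \<open>z + z = z\<close> the additivity relation is the negative of the generator itself.\<close>

lemma TK_zero_left:
  assumes "z \<in> carrier U" "w \<in> carrier W" "z \<oplus>\<^bsub>U\<^esub> z = z"
  shows "frag_of (z, w) \<in> TK"
  using TK_minus[OF TK_add_left[OF assms(1,1,2)]] assms(3) by simp

lemma TK_zero_right:
  assumes "u \<in> carrier U" "z \<in> carrier W" "z \<oplus>\<^bsub>W\<^esub> z = z"
  shows "frag_of (u, z) \<in> TK"
  using TK_minus[OF TK_add_right[OF assms(1,2,2)]] assms(3) by simp

end

section \<open>Trivial quotient groups\<close>

text \<open>With the kernel as \<open>G\<close> and the image as \<open>H\<close>, homology vanishes exactly where the complex is exact.\<close>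

lemma trivial_quotient_iff:
  assumes "comm_group G" "subgroup H G"
  shows "trivial_group (G Mod H) \<longleftrightarrow> H = carrier G"
proof -
  interpret comm_group G by fact
  interpret H: subgroup H G by fact
  have nor: "H \<lhd> G" using assms(2) by (simp add: normal_iff_subgroup)
  have "(\<forall>x\<in>carrier G. H #>\<^bsub>G\<^esub> x = H) \<longleftrightarrow> H = carrier G"
    using coset_join1[OF _ _ assms(2)] coset_join2[OF _ assms(2)] H.subset by blast
  moreover have "carrier (G Mod H) = {H} \<longleftrightarrow> (\<forall>x\<in>carrier G. H #>\<^bsub>G\<^esub> x = H)"
    by (auto simp: FactGroup_def RCOSETS_def)
  ultimately show ?thesis
    using normal.factorgroup_is_group[OF nor] by (simp add: trivial_group_def)
qed

section \<open>Borders and periods of words\<close>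

definition has_border :: "'a list \<Rightarrow> nat \<Rightarrow> bool" where
  "has_border f p \<longleftrightarrow> 0 < p \<and> p < length f \<and> take p f = drop (length f - p) f"

text \<open>Removing the first \<open>m\<close> letters leaves a shorter word with the same period.\<close>

lemma periodic_decomposition:
  assumes "0 < m" "drop m f = take (length f - m) f"
  shows "f = concat (replicate (length f div m) (take m f)) @ take (length f mod m) f"
  using assms(2)
proof (induction "length f" arbitrary: f rule: less_induct)
  case less
  show ?case
  proof (cases "length f < m")
    case True
    then show ?thesis by simp
  next
    case False
    define g where "g = drop m f"
    have len: "length g = length f - m" by (simp add: g_def)
    have g: "g = take (length f - m) f" using less.prems by (simp add: g_def)
    have "drop m g = take (length f - m - m) (drop m f)"
      by (subst g) (simp add: drop_take)
    then have "drop m g = take (length g - m) g" by (simp add: len g_def)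
    then have IH: "g = concat (replicate (length g div m) (take m g)) @ take (length g mod m) g"
      using less.hyps[of g] len False assms(1) by simp
    have mod: "length g mod m = length f mod m"
      using False by (simp add: len le_mod_geq)
    have div: "length f div m = Suc (length g div m)"
      using False assms(1) by (simp add: len le_div_geq)
    have period: "replicate (length g div m) (take m g) = replicate (length g div m) (take m f)"
    proof (cases "length g < m")
      case False
      then show ?thesis using len by (subst g) simp
    qed simp
    have rest: "take (length g mod m) g = take (length f mod m) f"
      unfolding mod[symmetric] using len mod_less_eq_dividend[of "length g" m]
      by (subst (2) g) simp
    have "g = concat (replicate (length g div m) (take m f)) @ take (length f mod m) f"
      using IH unfolding period rest .
    then have "take m f @ g = concat (replicate (length f div m) (take m f)) @ take (length f mod m) f"
      by (simp add: div)
    then show ?thesis by (simp add: g_def)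
  qed
qed

text \<open>Conversely, \<open>f = u\<^sup>q u'\<close> with \<open>u'\<close> a prefix of \<open>u\<close> begins with
  \<open>u\<^sup>q\<^sup>-\<^sup>1 u'\<close>, and that is also what is left after removing the first \<open>u\<close>.\<close>

lemma drop_periodic_decomposition:
  assumes m: "m \<le> length f" and q: "0 < q"
    and f: "f = concat (replicate q (take m f)) @ take r (take m f)"
  shows "drop m f = take (length f - m) f"
proof -
  define u where "u = take m f"
  define X where "X = concat (replicate (q - 1) u) @ take r u"
  have len: "length u = m" using m by (simp add: u_def)
  have "concat (replicate q u) = u @ concat (replicate (q - 1) u)"
    using q by (cases q) auto
  then have f1: "f = u @ X" using f by (simp add: X_def u_def)
  have "concat (replicate q u) = concat (replicate (q - 1) u) @ u"
    using q by (cases q) (auto simp flip: replicate_append_same)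
  then have "f = concat (replicate (q - 1) u) @ u @ take r u" using f by (simp add: u_def)
  also have "u = take r u @ drop r u" by simp
  finally have "f = X @ drop r u @ take r u" by (simp add: X_def)
  moreover have "length X = length f - m" using f1 len by (metis add_diff_cancel_left' length_append)
  ultimately have "take (length f - m) f = X" by (metis append_eq_conv_conj)
  moreover have "drop m f = X" using f1 len by (metis append_eq_conv_conj)
  ultimately show ?thesis by simp
qed

lemma constant_iff: "f = replicate (length f) b \<longleftrightarrow> set f \<subseteq> {b}"
  by (metis replicate_eqI set_replicate_conv_if subset_singletonD empty_subsetI subset_refl singletonD empty_iff)

text \<open>A border of length \<open>p\<close> is the same as a period \<open>m = N - p\<close>. The period \<open>1\<close> occurs only in
  powers of a letter, which is why the range of \<open>m\<close> may start at \<open>2\<close>.\<close>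

lemma border_iff_period:
  assumes nonconst: "\<not> (\<exists>b. set f \<subseteq> {b})"
  shows "(\<exists>p. has_border f p) \<longleftrightarrow> (\<exists>m\<in>{2..length f - 1}.
    f = concat (replicate (length f div m) (take m f)) @ take (length f mod m) f \<and>
    \<not> (\<exists>b. set (take m f) \<subseteq> {b}))"
proof
  assume "\<exists>p. has_border f p"
  then obtain p where p: "0 < p" "p < length f" "take p f = drop (length f - p) f"
    by (auto simp: has_border_def)
  define m where "m = length f - p"
  have m: "0 < m" "m < length f" "drop m f = take (length f - m) f" using p by (auto simp: m_def)
  have f: "f = concat (replicate (length f div m) (take m f)) @ take (length f mod m) f"
    by (rule periodic_decomposition[OF m(1,3)])
  have nc: "\<not> set (take m f) \<subseteq> {b}" for b
  proof
    assume "set (take m f) \<subseteq> {b}"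
    moreover have "set (take (length f mod m) f) \<subseteq> set (take m f)"
      using m(1) by (intro set_take_subset_set_take) (simp add: less_imp_le)
    moreover have "set f = set (concat (replicate (length f div m) (take m f)) @ take (length f mod m) f)"
      using f by simp
    ultimately have "set f \<subseteq> {b}" by (auto split: if_splits)
    then show False using nonconst by blast
  qed
  \<comment> \<open>Period \<open>1\<close> would make the word constant.\<close>
  have "m \<noteq> 1"
  proof
    assume "m = 1"
    moreover have "take 1 f = [hd f]" using p(2) by (cases f) auto
    ultimately show False using nc[of "hd f"] by simp
  qed
  with nc show "\<exists>m\<in>{2..length f - 1}.
      f = concat (replicate (length f div m) (take m f)) @ take (length f mod m) f \<and>
      \<not> (\<exists>b. set (take m f) \<subseteq> {b})"
    using m f by (intro bexI[of _ m]) auto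
next
  assume "\<exists>m\<in>{2..length f - 1}.
      f = concat (replicate (length f div m) (take m f)) @ take (length f mod m) f \<and>
      \<not> (\<exists>b. set (take m f) \<subseteq> {b})"
  then obtain m where m: "2 \<le> m" "m \<le> length f - 1"
    and f: "f = concat (replicate (length f div m) (take m f)) @ take (length f mod m) f" by auto
  have "take (length f mod m) f = take (length f mod m) (take m f)"
    using m(1) by (simp add: min_def less_imp_le)
  then have "drop m f = take (length f - m) f"
    using f m by (intro drop_periodic_decomposition[of _ _ "length f div m" "length f mod m"])
      (auto simp: div_greater_zero_iff)
  then have "has_border f (length f - m)" using m by (auto simp: has_border_def)
  then show "\<exists>p. has_border f p" ..
qed

section \<open>The free algebra on the vectors of V\<close>

lemma free_algebra_simps [simp]:
  "carrier free_algebra = UNIV"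
  "p \<otimes>\<^bsub>free_algebra\<^esub> q = p * q"
  "\<one>\<^bsub>free_algebra\<^esub> = 1"
  "\<zero>\<^bsub>free_algebra\<^esub> = 0"
  "p \<oplus>\<^bsub>free_algebra\<^esub> q = p + q"
  "c \<odot>\<^bsub>free_algebra\<^esub> p = Poly_Mapping.map ((*) c) p"
  by (simp_all add: free_algebra_def)

lemma ring_free_algebra: "ring (free_algebra :: ('k::field, 'v list \<Rightarrow>\<^sub>0 'k) module)"
proof (rule ringI)
  show "abelian_group (free_algebra :: ('k, 'v list \<Rightarrow>\<^sub>0 'k) module)"
  proof (rule abelian_groupI)
    fix p :: "'v list \<Rightarrow>\<^sub>0 'k"
    show "\<exists>q\<in>carrier free_algebra. q \<oplus>\<^bsub>free_algebra\<^esub> p = \<zero>\<^bsub>free_algebra\<^esub>"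
      by (rule bexI[of _ "- p"]) simp_all
  qed (simp_all add: ac_simps)
  show "Group.monoid (free_algebra :: ('k, 'v list \<Rightarrow>\<^sub>0 'k) module)"
    by (rule monoidI) (auto simp: mult.assoc)
qed (auto simp: algebra_simps)

lemma a_minus_free_algebra:
  fixes p q :: "'v list \<Rightarrow>\<^sub>0 'k::field"
  shows "p \<ominus>\<^bsub>free_algebra\<^esub> q = p - q"
proof -
  interpret ring "free_algebra :: ('k, 'v list \<Rightarrow>\<^sub>0 'k) module"
    by (rule ring_free_algebra)
  have "\<ominus>\<^bsub>free_algebra\<^esub> q = - q" by (rule minus_equality) simp_all
  then show ?thesis by (simp add: a_minus_def)
qed

lemma ideal_free_algebraI:
  fixes J :: "('v list \<Rightarrow>\<^sub>0 'k::field) set"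
  assumes "0 \<in> J" "\<And>p q. p \<in> J \<Longrightarrow> q \<in> J \<Longrightarrow> p + q \<in> J"
    and "\<And>p q. p \<in> J \<Longrightarrow> q * p \<in> J" "\<And>p q. p \<in> J \<Longrightarrow> p * q \<in> J"
  shows "ideal J free_algebra"
proof (rule idealI[OF ring_free_algebra])
  interpret ring "free_algebra :: ('k, 'v list \<Rightarrow>\<^sub>0 'k) module"
    by (rule ring_free_algebra)
  have "\<ominus>\<^bsub>free_algebra\<^esub> q = - q" for q :: "'v list \<Rightarrow>\<^sub>0 'k"
    by (rule minus_equality) simp_all
  moreover have "- p \<in> J" if "p \<in> J" for p using assms(3)[OF that, of "-1"] by simp
  ultimately show "subgroup J (add_monoid free_algebra)"
    using assms(1,2) by (intro add.subgroupI) auto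
qed (auto intro: assms)

lemma algebra_ideal_free_algebra:
  assumes "ideal J (free_algebra :: ('k::field, 'v list \<Rightarrow>\<^sub>0 'k) module)"
  shows "algebra_ideal J (free_algebra :: ('k::field, 'v list \<Rightarrow>\<^sub>0 'k) module)"
proof -
  interpret ideal J "free_algebra :: ('k::field, 'v list \<Rightarrow>\<^sub>0 'k) module" by fact
  show ?thesis
    using I_l_closed
    by unfold_locales (simp_all add: mult_map_scale_conv_mult distrib_left)
qed

section \<open>Words over a basis as a basis of the tensor algebra\<close>

locale word_basis = vector_space scale
  for scale :: "'k::field \<Rightarrow> 'v::ab_group_add \<Rightarrow> 'v" +
  fixes B :: "'v set"
  assumes finite_B: "finite B" and independent_B: "independent B" and span_B: "span B = UNIV"
begin

text \<open>The coefficient of the basis word \<open>w\<close> in the expansion of the pure tensor \<open>vs\<close>: the product of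
  the coordinates of the entries.\<close>

fun word_coord :: "'v list \<Rightarrow> 'v list \<Rightarrow> 'k" where
  "word_coord [] [] = 1"
| "word_coord (b # w) (v # vs) = representation B v b * word_coord w vs"
| "word_coord _ _ = 0"

lemma word_coord_eq_0: "length w \<noteq> length vs \<Longrightarrow> word_coord w vs = 0"
  by (induction w vs rule: word_coord.induct) auto

lemma word_coord_letter:
  "word_coord w [v] = (if length w = 1 then representation B v (hd w) else 0)"
proof (cases "length w = 1")
  case True
  then obtain b where "w = [b]" by (auto simp: length_Suc_conv)
  then show ?thesis by simp
qed (simp add: word_coord_eq_0)

lemma word_coord_append:
  "word_coord w (vs @ us) = word_coord (take (length vs) w) vs * word_coord (drop (length vs) w) us"
proof (induction vs arbitrary: w)
  case (Cons v vs)
  then show ?case by (cases w) auto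
qed simp

lemma word_coord_append':
  "word_coord w (vs @ us) =
    word_coord (take (length w - length us) w) vs * word_coord (drop (length w - length us) w) us"
proof (cases "length w = length vs + length us")
  case True
  then show ?thesis by (simp add: word_coord_append)
next
  case False
  then show ?thesis
    by (cases "length us \<le> length w") (auto simp: word_coord_eq_0)
qed

lemma word_coord_basis:
  "w \<in> lists B \<Longrightarrow> vs \<in> lists B \<Longrightarrow> word_coord w vs = (if w = vs then 1 else 0)"
  by (induction w vs rule: word_coord.induct)
     (auto simp: representation_basis[OF independent_B])

definition coeff :: "'v list \<Rightarrow> ('v list \<Rightarrow>\<^sub>0 'k) \<Rightarrow> 'k" where
  "coeff w p = (\<Sum>vs\<in>Poly_Mapping.keys p. Poly_Mapping.lookup p vs * word_coord w vs)"

lemma coeff_zero [simp]: "coeff w 0 = 0"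
  by (simp add: coeff_def)

lemma coeff_single [simp]: "coeff w (Poly_Mapping.single vs c) = c * word_coord w vs"
  by (simp add: coeff_def)

lemma coeff_add [simp]: "coeff w (p + q) = coeff w p + coeff w q"
  unfolding coeff_def by (rule setsum_keys_plus_distrib) (auto simp: algebra_simps)

lemma coeff_diff [simp]: "coeff w (p - q) = coeff w p - coeff w q"
  using coeff_add[of w "p - q" q] by (simp add: algebra_simps)

lemma coeff_eq_lookup:
  assumes "Poly_Mapping.keys p \<subseteq> lists B" "w \<in> lists B"
  shows "coeff w p = Poly_Mapping.lookup p w"
  using assms(1)
proof (induction p rule: poly_mapping_single_induct)
  case (single k c)
  with assms(2) show ?case by (simp add: word_coord_basis lookup_single when_def)
qed (auto simp: lookup_add)

lemma coeff_single_mult: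
  "coeff w (Poly_Mapping.single us d * p) =
    d * word_coord (take (length us) w) us * coeff (drop (length us) w) p"
  using subset_UNIV[of "Poly_Mapping.keys p"]
  by (induction p rule: poly_mapping_single_induct)
     (auto simp: single_mult_single word_coord_append algebra_simps)

lemma coeff_mult_single:
  "coeff w (p * Poly_Mapping.single us d) =
    coeff (take (length w - length us) w) p * (d * word_coord (drop (length w - length us) w) us)"
  using subset_UNIV[of "Poly_Mapping.keys p"]
  by (induction p rule: poly_mapping_single_induct)
     (auto simp: single_mult_single word_coord_append' algebra_simps)

definition lin_ideal :: "('v list \<Rightarrow>\<^sub>0 'k) set" where
  "lin_ideal = Idl\<^bsub>free_algebra\<^esub> (linearity_relations scale)"

lemma ideal_lin_ideal: "ideal lin_ideal free_algebra"
  unfolding lin_ideal_def by (rule ring.genideal_ideal[OF ring_free_algebra]) simp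

lemma linearity_relations_subset: "linearity_relations scale \<subseteq> lin_ideal"
  unfolding lin_ideal_def by (rule ring.genideal_self[OF ring_free_algebra]) simp

lemma lin_ideal_closed:
  shows lin_ideal_zero: "0 \<in> lin_ideal"
    and lin_ideal_add: "p \<in> lin_ideal \<Longrightarrow> q \<in> lin_ideal \<Longrightarrow> p + q \<in> lin_ideal"
    and lin_ideal_mult_left: "p \<in> lin_ideal \<Longrightarrow> q * p \<in> lin_ideal"
    and lin_ideal_mult_right: "p \<in> lin_ideal \<Longrightarrow> p * q \<in> lin_ideal"
proof -
  interpret ideal lin_ideal "free_algebra :: ('k, 'v list \<Rightarrow>\<^sub>0 'k) module"
    by (rule ideal_lin_ideal)
  show "0 \<in> lin_ideal"
    using additive_subgroup.zero_closed[OF ideal.axioms(1)[OF ideal_lin_ideal]] by simp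
  show "p \<in> lin_ideal \<Longrightarrow> q \<in> lin_ideal \<Longrightarrow> p + q \<in> lin_ideal"
    using additive_subgroup.a_closed[OF ideal.axioms(1)[OF ideal_lin_ideal]] by simp
  show "p \<in> lin_ideal \<Longrightarrow> q * p \<in> lin_ideal" using I_l_closed by simp
  show "p \<in> lin_ideal \<Longrightarrow> p * q \<in> lin_ideal" using I_r_closed by simp
qed

text \<open>The coefficient functionals factor through \<open>T(V)\<close>: their common kernel is a two-sided ideal, because the
  coefficients of a product with a pure tensor are multiples of coefficients of the other factor, and it
  contains the linearity relations because coordinates are linear.\<close>

lemma coeff_lin_ideal:
  assumes "p \<in> lin_ideal"
  shows "coeff w p = 0"
proof -
  let ?J = "{p. \<forall>w. coeff w p = 0}"
  have left: "coeff w (q * p) = 0" if "p \<in> ?J" for p q w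
    using subset_UNIV[of "Poly_Mapping.keys q"]
    by (induction q rule: poly_mapping_single_induct)
       (use that in \<open>auto simp: coeff_single_mult distrib_right\<close>)
  have right: "coeff w (p * q) = 0" if "p \<in> ?J" for p q w
    using subset_UNIV[of "Poly_Mapping.keys q"]
    by (induction q rule: poly_mapping_single_induct)
       (use that in \<open>auto simp: coeff_mult_single distrib_left\<close>)
  have "ideal ?J free_algebra"
    using left right by (intro ideal_free_algebraI) auto
  moreover have "linearity_relations scale \<subseteq> ?J"
  proof -
    have "word_coord w [v + v'] = word_coord w [v] + word_coord w [v']" for w v v'
      by (simp add: word_coord_letter representation_add[OF independent_B] span_B)
    moreover have "word_coord w [scale c v] = c * word_coord w [v]" for w c v
      by (simp add: word_coord_letter representation_scale[OF independent_B] span_B)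
    ultimately show ?thesis by (auto simp: linearity_relations_def)
  qed
  ultimately have "lin_ideal \<subseteq> ?J"
    unfolding lin_ideal_def by (rule ring.genideal_minimal[OF ring_free_algebra])
  with assms show ?thesis by auto
qed

lemma single_letter_mod_lin_ideal:
  "Poly_Mapping.single [v] 1 - (\<Sum>b\<in>B. Poly_Mapping.single [b] (representation B v b)) \<in> lin_ideal"
proof -
  have scal: "Poly_Mapping.single [scale c v] 1 - Poly_Mapping.single [v] c \<in> lin_ideal" for c v
    using linearity_relations_subset by (auto simp: linearity_relations_def)
  have add: "Poly_Mapping.single [v + w] 1 - (Poly_Mapping.single [v] 1 + Poly_Mapping.single [w] 1) \<in> lin_ideal"
    for v w
    using linearity_relations_subset by (auto simp: linearity_relations_def)
  have "Poly_Mapping.single [\<Sum>b\<in>F. scale (c b) b] 1 - (\<Sum>b\<in>F. Poly_Mapping.single [b] (c b)) \<in> lin_ideal"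
    if "finite F" for F :: "'v set" and c
    using that
  proof (induction F rule: finite_induct)
    case empty
    then show ?case using scal[of 0 0] by simp
  next
    case (insert b F)
    have eq: "Poly_Mapping.single [\<Sum>b\<in>insert b F. scale (c b) b] 1 - (\<Sum>b\<in>insert b F. Poly_Mapping.single [b] (c b))
      = (Poly_Mapping.single [scale (c b) b + (\<Sum>b\<in>F. scale (c b) b)] 1
          - (Poly_Mapping.single [scale (c b) b] 1 + Poly_Mapping.single [\<Sum>b\<in>F. scale (c b) b] 1))
        + (Poly_Mapping.single [scale (c b) b] 1 - Poly_Mapping.single [b] (c b))
        + (Poly_Mapping.single [\<Sum>b\<in>F. scale (c b) b] 1 - (\<Sum>b\<in>F. Poly_Mapping.single [b] (c b)))"
      using insert by simp
    show ?case unfolding eq using insert scal add by (intro lin_ideal_add)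
  qed
  from this[OF finite_B, of "representation B v"] show ?thesis
    by (simp add: sum_representation_eq[OF independent_B _ finite_B order.refl] span_B)
qed

definition words :: "nat \<Rightarrow> 'v list set" where
  "words m = {w \<in> lists B. length w = m}"

lemma words_subset_lists: "words m \<subseteq> lists B"
  by (auto simp: words_def)

lemma finite_words: "finite (words m)"
proof -
  have "words m = {w. set w \<subseteq> B \<and> length w = m}" by (auto simp: words_def)
  then show ?thesis using finite_lists_length_eq[OF finite_B] by simp
qed

text \<open>Expanding each entry of a pure tensor in the basis, one letter at a time, turns it into a linear
  combination of words of the same length.\<close>

lemma word_mod_lin_ideal:
  "\<exists>q. Poly_Mapping.keys q \<subseteq> words (length vs) \<and> Poly_Mapping.single vs 1 - q \<in> lin_ideal"
proof (induction vs)
  case Nil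
  show ?case
    by (rule exI[of _ "Poly_Mapping.single [] 1"]) (auto simp: words_def lin_ideal_zero)
next
  case (Cons v vs)
  then obtain q where q: "Poly_Mapping.keys q \<subseteq> words (length vs)"
    "Poly_Mapping.single vs 1 - q \<in> lin_ideal" by blast
  let ?l = "\<Sum>b\<in>B. Poly_Mapping.single [b] (representation B v b)"
  have "Poly_Mapping.keys ?l \<subseteq> words 1"
    by (rule keys_sum_subset) (auto simp: words_def)
  then have "Poly_Mapping.keys (?l * q) \<subseteq> words (length (v # vs))"
    using q(1) keys_mult_words[of ?l q] by (fastforce simp: words_def)
  moreover have "Poly_Mapping.single (v # vs) 1 - ?l * q =
      (Poly_Mapping.single [v] 1 - ?l) * Poly_Mapping.single vs 1 + ?l * (Poly_Mapping.single vs 1 - q)"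
    by (simp add: algebra_simps single_mult_single)
  then have "Poly_Mapping.single (v # vs) 1 - ?l * q \<in> lin_ideal"
    using single_letter_mod_lin_ideal[of v] q(2)
    by (simp add: lin_ideal_add lin_ideal_mult_left lin_ideal_mult_right)
  ultimately show ?case by blast
qed

subsection \<open>Computing in the tensor algebra with representatives\<close>

abbreviation T :: "('k, ('v list \<Rightarrow>\<^sub>0 'k) set) module" where
  "T \<equiv> tensor_algebra scale"

definition tclass :: "('v list \<Rightarrow>\<^sub>0 'k) \<Rightarrow> ('v list \<Rightarrow>\<^sub>0 'k) set" where
  "tclass p = lin_ideal +>\<^bsub>free_algebra\<^esub> p"

lemma tensor_algebra_eq: "T = free_algebra QuotAlg lin_ideal"
  by (simp add: tensor_algebra_def lin_ideal_def)

lemma pure_tensor_eq: "pure_tensor scale vs = tclass (Poly_Mapping.single vs 1)"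
  by (simp add: pure_tensor_def tclass_def lin_ideal_def)

lemma algebra_ideal_lin_ideal: "algebra_ideal lin_ideal (free_algebra :: ('k, 'v list \<Rightarrow>\<^sub>0 'k) module)"
  by (rule algebra_ideal_free_algebra[OF ideal_lin_ideal])

lemma ring_T: "ring T"
  unfolding tensor_algebra_eq by (rule algebra_ideal.ring_QuotAlg[OF algebra_ideal_lin_ideal])

lemma carrier_T_range: "carrier T = range tclass"
  unfolding tensor_algebra_eq
  by (auto simp: algebra_ideal.carrier_QuotAlg[OF algebra_ideal_lin_ideal] tclass_def)

lemma tclass_in_carrier [simp]: "tclass p \<in> carrier T"
  by (simp add: carrier_T_range)

lemma tclass_ops:
  shows tclass_add: "tclass p \<oplus>\<^bsub>T\<^esub> tclass q = tclass (p + q)"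
    and tclass_mult: "tclass p \<otimes>\<^bsub>T\<^esub> tclass q = tclass (p * q)"
    and tclass_zero: "\<zero>\<^bsub>T\<^esub> = tclass 0"
    and tclass_one: "\<one>\<^bsub>T\<^esub> = tclass 1"
    and tclass_smult: "c \<odot>\<^bsub>T\<^esub> tclass p = tclass (Poly_Mapping.map ((*) c) p)"
  unfolding tensor_algebra_eq tclass_def
  by (simp_all add: algebra_ideal.add_QuotAlg[OF algebra_ideal_lin_ideal]
      algebra_ideal.mult_QuotAlg[OF algebra_ideal_lin_ideal]
      algebra_ideal.zero_QuotAlg[OF algebra_ideal_lin_ideal]
      algebra_ideal.one_QuotAlg[OF algebra_ideal_lin_ideal]
      algebra_ideal.smult_QuotAlg[OF algebra_ideal_lin_ideal])

lemma tclass_eq_iff_diff: "tclass p = tclass q \<longleftrightarrow> p - q \<in> lin_ideal"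
  unfolding tclass_def
  by (simp add: algebra_ideal.coset_eq_iff[OF algebra_ideal_lin_ideal] a_minus_free_algebra)

lemma tclass_minus: "\<ominus>\<^bsub>T\<^esub> tclass p = tclass (- p)"
proof -
  interpret ring T by (rule ring_T)
  show ?thesis by (rule minus_equality) (simp_all add: tclass_ops)
qed

lemma tclass_diff: "tclass p \<ominus>\<^bsub>T\<^esub> tclass q = tclass (p - q)"
  by (simp add: a_minus_def tclass_minus tclass_add)

text \<open>Linear independence of the words over the basis in \<open>T(V)\<close>, with \<open>coeff\<close> as dual basis.\<close>

lemma tclass_inject:
  assumes "Poly_Mapping.keys p \<subseteq> lists B" "Poly_Mapping.keys q \<subseteq> lists B"
  shows "tclass p = tclass q \<longleftrightarrow> p = q"
proof
  assume "tclass p = tclass q"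
  then have zero: "coeff w (p - q) = 0" for w
    by (simp add: tclass_eq_iff_diff coeff_lin_ideal del: coeff_diff)
  have "Poly_Mapping.lookup p w = Poly_Mapping.lookup q w" if "w \<in> lists B" for w
    using zero[of w] coeff_eq_lookup[OF assms(1) that] coeff_eq_lookup[OF assms(2) that] by simp
  moreover have "Poly_Mapping.lookup p w = 0" "Poly_Mapping.lookup q w = 0" if "w \<notin> lists B" for w
    using assms that by (auto simp: in_keys_iff subset_iff)
  ultimately show "p = q" by (intro poly_mapping_eqI) metis
qed simp

lemma tclass_word: "\<exists>q. Poly_Mapping.keys q \<subseteq> words (length vs) \<and> tclass (Poly_Mapping.single vs 1) = tclass q"
  using word_mod_lin_ideal[of vs] by (simp add: tclass_eq_iff_diff)

lemma single_conv_map: "Poly_Mapping.single k c = Poly_Mapping.map ((*) c) (Poly_Mapping.single k (1::'k))"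
  by simp

lemma keys_map_mult_subset: "Poly_Mapping.keys (Poly_Mapping.map ((*) c) p) \<subseteq> Poly_Mapping.keys p"
  for c :: 'k
  by (auto simp: in_keys_iff map.rep_eq when_def)

lemma lookup_map_mult: "Poly_Mapping.lookup (Poly_Mapping.map ((*) c) p) w = c * Poly_Mapping.lookup p w"
  for c :: 'k
  by (auto simp: map.rep_eq when_def)

lemma tclass_representative:
  obtains q where "Poly_Mapping.keys q \<subseteq> lists B" "tclass p = tclass q"
proof -
  have "\<exists>q. Poly_Mapping.keys q \<subseteq> lists B \<and> tclass p = tclass q"
    using subset_UNIV[of "Poly_Mapping.keys p"]
  proof (induction p rule: poly_mapping_single_induct)
    case zero
    then show ?case by (intro exI[of _ 0]) simp
  next
    case (single vs c)
    obtain q where q: "Poly_Mapping.keys q \<subseteq> words (length vs)"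
      "tclass (Poly_Mapping.single vs 1) = tclass q"
      using tclass_word by blast
    have "tclass (Poly_Mapping.single vs c) = tclass (Poly_Mapping.map ((*) c) q)"
      by (metis q(2) single_conv_map tclass_smult)
    then show ?case
      using q(1) keys_map_mult_subset[of c q] words_subset_lists by blast
  next
    case (add p p')
    then obtain q q' where "Poly_Mapping.keys q \<subseteq> lists B" "tclass p = tclass q"
      "Poly_Mapping.keys q' \<subseteq> lists B" "tclass p' = tclass q'" by blast
    then show ?case
      using keys_add[of q q'] by (intro exI[of _ "q + q'"] conjI) (blast, simp flip: tclass_add)
  qed
  then show thesis using that by blast
qed

lemma carrier_T: "carrier T = tclass ` {p. Poly_Mapping.keys p \<subseteq> lists B}"
proof -
  have "tclass p \<in> tclass ` {p. Poly_Mapping.keys p \<subseteq> lists B}" for p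
    by (rule tclass_representative[of p]) blast
  then show ?thesis by (auto simp: carrier_T_range)
qed

subsection \<open>Spans of words\<close>

definition word_span :: "'v list set \<Rightarrow> ('v list \<Rightarrow>\<^sub>0 'k) set set" where
  "word_span Z = tclass ` {p. Poly_Mapping.keys p \<subseteq> Z}"

lemma tclass_in_word_span: "Poly_Mapping.keys p \<subseteq> Z \<Longrightarrow> tclass p \<in> word_span Z"
  by (auto simp: word_span_def)

lemma tclass_in_word_span_iff:
  assumes "Poly_Mapping.keys p \<subseteq> lists B" "Z \<subseteq> lists B"
  shows "tclass p \<in> word_span Z \<longleftrightarrow> Poly_Mapping.keys p \<subseteq> Z"
  using assms tclass_inject by (fastforce simp: word_span_def)

lemma submodule_word_span: "submodule (word_span Z) base_field T"
proof (rule submodule.intro)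
  interpret ring T by (rule ring_T)
  show "subgroup (word_span Z) (add_monoid T)"
  proof (rule add.subgroupI)
    show "word_span Z \<noteq> {}" using tclass_in_word_span[of 0] by auto
    fix a b assume "a \<in> word_span Z" "b \<in> word_span Z"
    then obtain p q where "Poly_Mapping.keys p \<subseteq> Z" "a = tclass p" "Poly_Mapping.keys q \<subseteq> Z" "b = tclass q"
      by (auto simp: word_span_def)
    then show "a \<oplus>\<^bsub>T\<^esub> b \<in> word_span Z"
      using keys_add[of p q] by (auto simp: tclass_add intro!: tclass_in_word_span)
  next
    fix a assume "a \<in> word_span Z"
    then show "\<ominus>\<^bsub>T\<^esub> a \<in> word_span Z"
      by (auto simp: word_span_def tclass_minus intro!: imageI)
  qed (auto simp: word_span_def)
  show "submodule_axioms (word_span Z) base_field T"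
  proof
    fix c a assume "a \<in> word_span Z"
    then obtain p where "Poly_Mapping.keys p \<subseteq> Z" "a = tclass p" by (auto simp: word_span_def)
    then show "c \<odot>\<^bsub>T\<^esub> a \<in> word_span Z"
      using keys_map_mult_subset[of c p] by (auto simp: tclass_smult intro!: tclass_in_word_span)
  qed
qed

lemma word_span_closed:
  shows word_span_add: "a \<in> word_span Z \<Longrightarrow> b \<in> word_span Z \<Longrightarrow> a \<oplus>\<^bsub>T\<^esub> b \<in> word_span Z"
    and word_span_smult: "a \<in> word_span Z \<Longrightarrow> c \<odot>\<^bsub>T\<^esub> a \<in> word_span Z"
proof -
  interpret submodule "word_span Z" base_field T by (rule submodule_word_span)
  show "a \<in> word_span Z \<Longrightarrow> b \<in> word_span Z \<Longrightarrow> a \<oplus>\<^bsub>T\<^esub> b \<in> word_span Z"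
    using m_closed by simp
  show "a \<in> word_span Z \<Longrightarrow> c \<odot>\<^bsub>T\<^esub> a \<in> word_span Z"
    by (rule smult_closed) (simp add: base_field_def)
qed

text \<open>Every span that occurs in the Koszul complex is identified in this way, by exhibiting words that it
  contains and that already span it.\<close>

lemma lin_span_eq_word_span:
  assumes "G \<subseteq> word_span Z"
    and "\<And>s. s \<in> Z \<Longrightarrow> tclass (Poly_Mapping.single s 1) \<in> G"
  shows "lin_span T G = word_span Z"
proof
  from submodule_word_span assms(1) show "lin_span T G \<subseteq> word_span Z" by (auto simp: lin_span_def)
  show "word_span Z \<subseteq> lin_span T G"
  proof
    fix t assume "t \<in> word_span Z"
    then obtain p where p: "Poly_Mapping.keys p \<subseteq> Z" "t = tclass p" by (auto simp: word_span_def)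
    have "tclass p \<in> H" if H: "submodule H base_field T" "G \<subseteq> H" for H
      using p(1)
    proof (induction p rule: poly_mapping_single_induct)
      interpret submodule H base_field T by fact
      { case zero
        show ?case using one_closed by (simp add: tclass_zero) }
      { case (single k c)
        have "c \<odot>\<^bsub>T\<^esub> tclass (Poly_Mapping.single k 1) \<in> H"
          using assms(2)[OF single] H(2) by (intro smult_closed) (auto simp: base_field_def)
        then show ?case by (simp add: tclass_smult) }
      { case (add p q)
        then show ?case using m_closed by (simp flip: tclass_add) }
    qed
    with p(2) show "t \<in> lin_span T G" by (auto simp: lin_span_def)
  qed
qed

lemma tensor_power_eq: "tensor_power scale m = word_span (words m)"
  unfolding tensor_power_def
proof (rule lin_span_eq_word_span)
  show "{pure_tensor scale vs |vs. length vs = m} \<subseteq> word_span (words m)"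
  proof
    fix t assume "t \<in> {pure_tensor scale vs |vs. length vs = m}"
    then obtain vs where "t = tclass (Poly_Mapping.single vs 1)" "length vs = m"
      by (auto simp: pure_tensor_eq)
    then show "t \<in> word_span (words m)"
      using tclass_word[of vs] by (auto intro: tclass_in_word_span)
  qed
qed (auto simp: pure_tensor_eq words_def)

end

section \<open>The algebra with one monomial relation\<close>

locale monomial_relation = word_basis scale B
  for scale :: "'k::field \<Rightarrow> 'v::ab_group_add \<Rightarrow> 'v" and B :: "'v set" +
  fixes f :: "'v list"
  assumes f_word: "f \<in> lists B" and length_f: "length f \<ge> 2"
begin

abbreviation N :: nat where "N \<equiv> length f"
abbreviation R :: "('v list \<Rightarrow>\<^sub>0 'k) set set" where "R \<equiv> word_span {f}"
abbreviation A :: "('k, ('v list \<Rightarrow>\<^sub>0 'k) set set) module" where "A \<equiv> relation_algebra scale R"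

text \<open>The words whose classes form a basis of \<open>A\<close>.\<close>

definition normal_word :: "'v list \<Rightarrow> bool" where
  "normal_word w \<longleftrightarrow> w \<in> lists B \<and> \<not> sublist f w"

definition rel_ideal :: "('v list \<Rightarrow>\<^sub>0 'k) set set" where
  "rel_ideal = Idl\<^bsub>T\<^esub> R"

lemma R_subset_carrier: "R \<subseteq> carrier T"
  using f_word by (auto simp: word_span_def)

lemma ideal_rel_ideal: "ideal rel_ideal T"
  unfolding rel_ideal_def by (rule ring.genideal_ideal[OF ring_T R_subset_carrier])

text \<open>A product of words has a factor \<open>f\<close> as soon as one of them does, so the span on the right is an
  ideal; it is the smallest one containing \<open>f\<close>, since \<open>u f v\<close> lies in every such ideal.\<close>

lemma rel_ideal_eq: "rel_ideal = word_span {w \<in> lists B. sublist f w}" (is "_ = word_span ?Z")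
proof
  have "ideal (word_span ?Z) T"
  proof (rule idealI[OF ring_T])
    show "subgroup (word_span ?Z) (add_monoid T)"
      using submodule_word_span by (rule submodule.axioms)
  next
    fix a t assume "a \<in> word_span ?Z" "t \<in> carrier T"
    then obtain p q where p: "Poly_Mapping.keys p \<subseteq> ?Z" "a = tclass p"
      and q: "Poly_Mapping.keys q \<subseteq> lists B" "t = tclass q"
      by (auto simp: word_span_def carrier_T)
    have "Poly_Mapping.keys (q * p) \<subseteq> ?Z"
    proof
      fix w assume "w \<in> Poly_Mapping.keys (q * p)"
      then obtain u v where "w = u @ v" "u \<in> Poly_Mapping.keys q" "v \<in> Poly_Mapping.keys p"
        using keys_mult_words by blast
      moreover from this have "sublist f v" "u \<in> lists B" "v \<in> lists B" using p q by blast+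
      ultimately show "w \<in> ?Z" by (auto simp: sublist_append)
    qed
    then show "t \<otimes>\<^bsub>T\<^esub> a \<in> word_span ?Z"
      using p q by (auto simp: tclass_mult intro: tclass_in_word_span)
    have "Poly_Mapping.keys (p * q) \<subseteq> ?Z"
    proof
      fix w assume "w \<in> Poly_Mapping.keys (p * q)"
      then obtain u v where "w = u @ v" "u \<in> Poly_Mapping.keys p" "v \<in> Poly_Mapping.keys q"
        using keys_mult_words by blast
      moreover from this have "sublist f u" "u \<in> lists B" "v \<in> lists B" using p q by blast+
      ultimately show "w \<in> ?Z" by (auto simp: sublist_append)
    qed
    then show "a \<otimes>\<^bsub>T\<^esub> t \<in> word_span ?Z"
      using p q by (auto simp: tclass_mult intro: tclass_in_word_span)
  qed
  moreover have "R \<subseteq> word_span ?Z" using f_word by (auto simp: word_span_def)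
  ultimately show "rel_ideal \<subseteq> word_span ?Z"
    unfolding rel_ideal_def by (rule ring.genideal_minimal[OF ring_T])
next
  interpret ideal rel_ideal T by (rule ideal_rel_ideal)
  have "R \<subseteq> rel_ideal"
    unfolding rel_ideal_def by (rule ring.genideal_self[OF ring_T R_subset_carrier])
  then have f: "tclass (Poly_Mapping.single f 1) \<in> rel_ideal"
    using tclass_in_word_span[of "Poly_Mapping.single f 1" "{f}"] by auto
  have "tclass p \<in> rel_ideal" if "Poly_Mapping.keys p \<subseteq> ?Z" for p
    using that
  proof (induction p rule: poly_mapping_single_induct)
    case zero
    show ?case
      using additive_subgroup.zero_closed[OF additive_subgroup_axioms] by (simp add: tclass_zero)
  next
    case (single k c)
    then obtain u v where "k = u @ f @ v" by (auto simp: sublist_def)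
    then have "tclass (Poly_Mapping.single k c) =
      (tclass (Poly_Mapping.single u c) \<otimes>\<^bsub>T\<^esub> tclass (Poly_Mapping.single f 1)) \<otimes>\<^bsub>T\<^esub> tclass (Poly_Mapping.single v 1)"
      by (simp add: tclass_mult single_mult_single)
    then show ?case using f by (simp add: I_l_closed I_r_closed)
  next
    case (add p q)
    then show ?case
      using additive_subgroup.a_closed[OF additive_subgroup_axioms] by (simp flip: tclass_add)
  qed
  then show "word_span ?Z \<subseteq> rel_ideal" by (auto simp: word_span_def)
qed

lemma map_mult_add:
  "Poly_Mapping.map ((*) c) (p + q) = Poly_Mapping.map ((*) c) p + Poly_Mapping.map ((*) (c::'k)) q"
  by (intro poly_mapping_eqI) (simp add: lookup_map_mult lookup_add distrib_left)

lemma algebra_ideal_rel_ideal: "algebra_ideal rel_ideal T"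
proof -
  interpret ideal rel_ideal T by (rule ideal_rel_ideal)
  show ?thesis
  proof
    fix a c assume "a \<in> carrier T"
    then show "c \<odot>\<^bsub>T\<^esub> a \<in> carrier T" by (auto simp: carrier_T_range tclass_smult)
  next
    fix a c assume "a \<in> rel_ideal"
    then show "c \<odot>\<^bsub>T\<^esub> a \<in> rel_ideal" unfolding rel_ideal_eq by (rule word_span_smult)
  next
    fix a b c assume "a \<in> carrier T" "b \<in> carrier T"
    then show "c \<odot>\<^bsub>T\<^esub> (a \<oplus>\<^bsub>T\<^esub> b) = c \<odot>\<^bsub>T\<^esub> a \<oplus>\<^bsub>T\<^esub> c \<odot>\<^bsub>T\<^esub> b"
      by (auto simp: carrier_T_range tclass_add tclass_smult map_mult_add)
  qed
qed

definition aclass :: "('v list \<Rightarrow>\<^sub>0 'k) \<Rightarrow> ('v list \<Rightarrow>\<^sub>0 'k) set set" where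
  "aclass p = algebra_class scale R (tclass p)"

lemma relation_algebra_eq: "A = T QuotAlg rel_ideal"
  by (simp add: relation_algebra_def rel_ideal_def)

lemma ring_A: "ring A"
  unfolding relation_algebra_eq by (rule algebra_ideal.ring_QuotAlg[OF algebra_ideal_rel_ideal])

lemma aclass_eq: "aclass p = rel_ideal +>\<^bsub>T\<^esub> tclass p"
  by (simp add: aclass_def algebra_class_def rel_ideal_def)

lemma carrier_A: "carrier A = aclass ` {p. Poly_Mapping.keys p \<subseteq> lists B}"
  unfolding relation_algebra_eq
  by (auto simp: algebra_ideal.carrier_QuotAlg[OF algebra_ideal_rel_ideal] aclass_eq carrier_T)

lemma aclass_in_carrier [simp]: "aclass p \<in> carrier A"
  unfolding relation_algebra_eq
  by (auto simp: algebra_ideal.carrier_QuotAlg[OF algebra_ideal_rel_ideal] aclass_eq)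

lemma aclass_ops:
  shows aclass_add: "aclass p \<oplus>\<^bsub>A\<^esub> aclass q = aclass (p + q)"
    and aclass_mult: "aclass p \<otimes>\<^bsub>A\<^esub> aclass q = aclass (p * q)"
    and aclass_smult: "c \<odot>\<^bsub>A\<^esub> aclass p = aclass (Poly_Mapping.map ((*) c) p)"
  unfolding relation_algebra_eq aclass_eq
  by (simp_all add: algebra_ideal.add_QuotAlg[OF algebra_ideal_rel_ideal]
      algebra_ideal.mult_QuotAlg[OF algebra_ideal_rel_ideal]
      algebra_ideal.smult_QuotAlg[OF algebra_ideal_rel_ideal] tclass_ops)

lemma aclass_eq_iff:
  assumes "Poly_Mapping.keys p \<subseteq> lists B" "Poly_Mapping.keys q \<subseteq> lists B"
  shows "aclass p = aclass q \<longleftrightarrow>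
    (\<forall>w. normal_word w \<longrightarrow> Poly_Mapping.lookup p w = Poly_Mapping.lookup q w)"
proof -
  have pq: "Poly_Mapping.keys (p - q) \<subseteq> lists B"
    using keys_diff_subset[of p q] assms by blast
  have "aclass p = aclass q \<longleftrightarrow> tclass (p - q) \<in> rel_ideal"
    by (simp add: aclass_eq algebra_ideal.coset_eq_iff[OF algebra_ideal_rel_ideal] tclass_diff)
  also have "\<dots> \<longleftrightarrow> Poly_Mapping.keys (p - q) \<subseteq> {w \<in> lists B. sublist f w}"
    unfolding rel_ideal_eq using pq by (intro tclass_in_word_span_iff) auto
  also have "\<dots> \<longleftrightarrow> (\<forall>w. normal_word w \<longrightarrow> w \<notin> Poly_Mapping.keys (p - q))"
    using pq unfolding normal_word_def by blast
  also have "\<dots> \<longleftrightarrow> (\<forall>w. normal_word w \<longrightarrow> Poly_Mapping.lookup p w = Poly_Mapping.lookup q w)"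
    by (simp add: in_keys_iff lookup_minus)
  finally show ?thesis .
qed

section \<open>The spaces W of the Koszul complex are spanned by words\<close>

definition koszul_words :: "nat \<Rightarrow> 'v list set" where
  "koszul_words m = {w \<in> words m. \<forall>t. sublist t w \<longrightarrow> length t = N \<longrightarrow> t = f}"

lemma koszul_words_subset: "koszul_words m \<subseteq> lists B"
  using words_subset_lists by (auto simp: koszul_words_def)

lemma finite_koszul_words: "finite (koszul_words m)"
  unfolding koszul_words_def using finite_words by simp

lemma koszul_words_sublist:
  assumes "w \<in> koszul_words m" "sublist t w"
  shows "t \<in> koszul_words (length t)"
  using assms set_mono_sublist[OF assms(2)] sublist_order.order.trans[OF _ assms(2)]
  unfolding koszul_words_def words_def by fastforce

lemma in_koszul_words_iff:
  assumes "w \<in> words m"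
  shows "w \<in> koszul_words m \<longleftrightarrow>
    (\<forall>i j. i + N + j = m \<longrightarrow> w \<in> {u @ f @ v | u v. u \<in> words i \<and> v \<in> words j})"
proof (intro iffI allI impI)
  fix i j assume w: "w \<in> koszul_words m" and m: "i + N + j = m"
  let ?u = "take i w" and ?t = "take N (drop i w)" and ?v = "drop (i + N) w"
  have "w = ?u @ ?t @ ?v"
    by (metis add.commute append_take_drop_id drop_drop)
  moreover have "sublist ?t w"
    using sublist_order.order.trans[OF sublist_take sublist_drop] by blast
  then have "?t = f"
    using w m assms unfolding koszul_words_def words_def by auto
  moreover have "?u \<in> words i" "?v \<in> words j"
    using assms m by (auto simp: words_def dest: in_set_takeD in_set_dropD)
  ultimately show "w \<in> {u @ f @ v | u v. u \<in> words i \<and> v \<in> words j}"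
    by (intro CollectI exI[of _ ?u] exI[of _ ?v]) simp
next
  assume *: "\<forall>i j. i + N + j = m \<longrightarrow> w \<in> {u @ f @ v | u v. u \<in> words i \<and> v \<in> words j}"
  have "t = f" if t: "sublist t w" "length t = N" for t
  proof -
    obtain ps ss where w: "w = ps @ t @ ss" using t(1) by (auto simp: sublist_def)
    have "length ps + N + length ss = m" using assms w t(2) by (simp add: words_def)
    then obtain u v where "w = u @ f @ v" "u \<in> words (length ps)" using * by blast
    then show "t = f" using w t(2) by (simp add: words_def)
  qed
  with assms show "w \<in> koszul_words m" by (simp add: koszul_words_def)
qed

text \<open>Each of the spaces that are intersected is spanned by words, and so an element lies in the
  intersection if and only if all words in its support do.\<close>

lemma koszul_space_eq: "koszul_space scale N R m = word_span (koszul_words m)"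
proof -
  let ?Z = "\<lambda>i j. {u @ f @ v | u v. u \<in> words i \<and> v \<in> words j}"
  have Z: "?Z i j \<subseteq> lists B" for i j
    using words_subset_lists f_word by fastforce
  have span: "lin_span T (tensor_power scale i <#>\<^bsub>T\<^esub> R <#>\<^bsub>T\<^esub> tensor_power scale j) = word_span (?Z i j)" for i j
  proof (rule lin_span_eq_word_span)
    show "tensor_power scale i <#>\<^bsub>T\<^esub> R <#>\<^bsub>T\<^esub> tensor_power scale j \<subseteq> word_span (?Z i j)"
    proof
      fix t assume "t \<in> tensor_power scale i <#>\<^bsub>T\<^esub> R <#>\<^bsub>T\<^esub> tensor_power scale j"
      then obtain p q r where p: "Poly_Mapping.keys p \<subseteq> words i" and q: "Poly_Mapping.keys q \<subseteq> {f}"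
        and r: "Poly_Mapping.keys r \<subseteq> words j" and t: "t = tclass (p * q * r)"
        by (auto simp: set_mult_def tensor_power_eq word_span_def tclass_mult)
      have "Poly_Mapping.keys (p * q * r) \<subseteq> ?Z i j"
      proof
        fix w assume "w \<in> Poly_Mapping.keys (p * q * r)"
        then obtain u v where uv: "w = u @ v" "u \<in> Poly_Mapping.keys (p * q)" "v \<in> Poly_Mapping.keys r"
          using keys_mult_words by blast
        then obtain u' f' where "u = u' @ f'" "u' \<in> Poly_Mapping.keys p" "f' \<in> Poly_Mapping.keys q"
          using keys_mult_words by blast
        with uv have "w = u' @ f @ v" "u' \<in> words i" "v \<in> words j" using p q r by auto
        then show "w \<in> ?Z i j" by auto
      qed
      then show "t \<in> word_span (?Z i j)" unfolding t by (rule tclass_in_word_span)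
    qed
  next
    fix s assume "s \<in> ?Z i j"
    then obtain u v where s: "s = u @ f @ v" "u \<in> words i" "v \<in> words j" by blast
    then have "tclass (Poly_Mapping.single s 1) = (tclass (Poly_Mapping.single u 1) \<otimes>\<^bsub>T\<^esub>
        tclass (Poly_Mapping.single f 1)) \<otimes>\<^bsub>T\<^esub> tclass (Poly_Mapping.single v 1)"
      by (simp add: tclass_mult single_mult_single)
    moreover have "tclass (Poly_Mapping.single u 1) \<in> tensor_power scale i"
      "tclass (Poly_Mapping.single f 1) \<in> R" "tclass (Poly_Mapping.single v 1) \<in> tensor_power scale j"
      using s by (auto simp: tensor_power_eq intro!: tclass_in_word_span)
    ultimately show "tclass (Poly_Mapping.single s 1) \<in> tensor_power scale i <#>\<^bsub>T\<^esub> R <#>\<^bsub>T\<^esub> tensor_power scale j"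
      unfolding set_mult_def by blast
  qed
  have "tclass p \<in> koszul_space scale N R m \<longleftrightarrow> tclass p \<in> word_span (koszul_words m)"
    if p: "Poly_Mapping.keys p \<subseteq> lists B" for p
  proof -
    have "tclass p \<in> koszul_space scale N R m \<longleftrightarrow>
      tclass p \<in> word_span (words m) \<and> (\<forall>i j. i + N + j = m \<longrightarrow> tclass p \<in> word_span (?Z i j))"
      unfolding koszul_space_def span unfolding tensor_power_eq by blast
    also have "\<dots> \<longleftrightarrow>
      Poly_Mapping.keys p \<subseteq> words m \<and> (\<forall>i j. i + N + j = m \<longrightarrow> Poly_Mapping.keys p \<subseteq> ?Z i j)"
      by (simp only: tclass_in_word_span_iff[OF p words_subset_lists] tclass_in_word_span_iff[OF p Z])
    also have "\<dots> \<longleftrightarrow> Poly_Mapping.keys p \<subseteq> koszul_words m"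
      using in_koszul_words_iff unfolding koszul_words_def by blast
    also have "\<dots> \<longleftrightarrow> tclass p \<in> word_span (koszul_words m)"
      using tclass_in_word_span_iff[OF p koszul_words_subset] by blast
    finally show ?thesis .
  qed
  moreover have "koszul_space scale N R m \<subseteq> tclass ` {p. Poly_Mapping.keys p \<subseteq> lists B}"
    using words_subset_lists unfolding koszul_space_def tensor_power_eq word_span_def by blast
  moreover have "word_span (koszul_words m) \<subseteq> tclass ` {p. Poly_Mapping.keys p \<subseteq> lists B}"
    using koszul_words_subset unfolding word_span_def by blast
  ultimately show ?thesis by blast
qed

section \<open>Coordinates on the modules of the Koszul complex\<close>

abbreviation polys :: "('v list \<Rightarrow>\<^sub>0 'k) set" where
  "polys \<equiv> {p. Poly_Mapping.keys p \<subseteq> lists B}"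

lemma polys_add: "p \<in> polys \<Longrightarrow> q \<in> polys \<Longrightarrow> p + q \<in> polys"
  using keys_add[of p q] by blast

lemma polys_diff: "p \<in> polys \<Longrightarrow> q \<in> polys \<Longrightarrow> p - q \<in> polys"
  using keys_diff_subset[of p q] by blast

lemma polys_mult: "p \<in> polys \<Longrightarrow> q \<in> polys \<Longrightarrow> p * q \<in> polys"
  using keys_mult_words[of p q] by fastforce

lemma polys_map: "p \<in> polys \<Longrightarrow> Poly_Mapping.map ((*) c) p \<in> polys" for c :: 'k
  using keys_map_mult_subset[of c p] by blast

lemma polys_sum: "(\<And>j. j \<in> J \<Longrightarrow> g j \<in> polys) \<Longrightarrow> sum g J \<in> polys"
  using keys_sum_subset[of J g "lists B"] by blast

lemma polys_single: "s \<in> lists B \<Longrightarrow> Poly_Mapping.single s c \<in> polys"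
  by simp

abbreviation W :: "nat \<Rightarrow> ('k, ('v list \<Rightarrow>\<^sub>0 'k) set) module" where
  "W i \<equiv> koszul_coeff scale N R i"

abbreviation K where "K i \<equiv> koszul_module scale N R i"

definition degree_words :: "nat \<Rightarrow> 'v list set" where
  "degree_words i = koszul_words (jump N i)"

lemma degree_words_subset: "degree_words i \<subseteq> lists B"
  by (simp add: degree_words_def koszul_words_subset)

lemma finite_degree_words: "finite (degree_words i)"
  by (simp add: degree_words_def finite_koszul_words)

lemma W_simps:
  "carrier (W i) = word_span (degree_words i)"
  "add (W i) = add T" "module.smult (W i) = module.smult T"
  by (simp_all add: koszul_coeff_def koszul_space_eq degree_words_def)

lemma W_representative:
  "t \<in> carrier (W i) \<Longrightarrow> \<exists>q. Poly_Mapping.keys q \<subseteq> degree_words i \<and> t = tclass q"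
  unfolding W_simps unfolding word_span_def by blast

lemma tensor_pair_koszul: "tensor_pair A (W i)"
proof
  interpret ring A by (rule ring_A)
  show "u \<oplus>\<^bsub>A\<^esub> u' \<in> carrier A" if "u \<in> carrier A" "u' \<in> carrier A" for u u'
    using that by (rule a_closed)
  show "c \<odot>\<^bsub>A\<^esub> u \<in> carrier A" if "u \<in> carrier A" for u c
  proof -
    obtain p where "u = aclass p" using \<open>u \<in> carrier A\<close> by (auto simp: carrier_A)
    then show ?thesis by (simp add: aclass_smult)
  qed
qed (auto simp: W_simps word_span_add word_span_smult)

lemma K_eq: "K i = tensor_product A (W i)"
  by (simp add: koszul_module_def)

abbreviation kernelT where "kernelT i \<equiv> tensor_kernel A (W i)"

definition kcoset where "kcoset i = tensor_pair.tensor_class A (W i)"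

definition kfrag where
  "kfrag i g = (\<Sum>s\<in>degree_words i. frag_of (aclass (g s), tclass (Poly_Mapping.single s 1)))"

text \<open>In the notation of tensors, \<open>kclass i g\<close> is \<open>\<Sum>\<^sub>s g(s) \<otimes> s\<close>, where \<open>s\<close> runs over the words
  of \<open>W\<close> in the degree of \<open>K\<^sub>i\<close>.\<close>

definition kclass where "kclass i g = kcoset i (kfrag i g)"

lemma comm_group_K: "comm_group (K i)"
  unfolding K_eq by (rule tensor_pair.comm_group_tensor_product[OF tensor_pair_koszul])

lemma kcoset_eq_iff: "kcoset i z = kcoset i z' \<longleftrightarrow> z - z' \<in> kernelT i"
  unfolding kcoset_def by (rule tensor_pair.tensor_class_eq_iff[OF tensor_pair_koszul])

lemma one_K: "\<one>\<^bsub>K i\<^esub> = kcoset i 0"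
  unfolding K_eq kcoset_def by (rule tensor_pair.one_tensor_product[OF tensor_pair_koszul])

lemma mult_K:
  assumes "Poly_Mapping.keys z \<subseteq> carrier A \<times> carrier (W i)" "Poly_Mapping.keys z' \<subseteq> carrier A \<times> carrier (W i)"
  shows "kcoset i z \<otimes>\<^bsub>K i\<^esub> kcoset i z' = kcoset i (z + z')"
  unfolding K_eq kcoset_def by (rule tensor_pair.mult_tensor_product[OF tensor_pair_koszul assms])

lemma word_in_W: "s \<in> degree_words i \<Longrightarrow> tclass (Poly_Mapping.single s c) \<in> carrier (W i)"
  unfolding W_simps by (rule tclass_in_word_span) simp

lemma keys_kfrag: "Poly_Mapping.keys (kfrag i g) \<subseteq> carrier A \<times> carrier (W i)"
  unfolding kfrag_def by (rule keys_sum_subset) (auto intro: word_in_W)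

lemma kfrag_add: "kfrag i (\<lambda>s. g s + h s) - (kfrag i g + kfrag i h) \<in> kernelT i"
proof -
  interpret tensor_pair A "W i" by (rule tensor_pair_koszul)
  have "kfrag i (\<lambda>s. g s + h s) - (kfrag i g + kfrag i h) =
    (\<Sum>s\<in>degree_words i. frag_of (aclass (g s) \<oplus>\<^bsub>A\<^esub> aclass (h s), tclass (Poly_Mapping.single s 1)) -
      (frag_of (aclass (g s), tclass (Poly_Mapping.single s 1)) + frag_of (aclass (h s), tclass (Poly_Mapping.single s 1))))"
    by (simp add: kfrag_def sum.distrib sum_subtractf aclass_add)
  also have "\<dots> \<in> kernelT i" by (intro TK_sum TK_add_left) (auto intro: word_in_W)
  finally show ?thesis .
qed

lemma kclass_add: "kclass i g \<otimes>\<^bsub>K i\<^esub> kclass i h = kclass i (\<lambda>s. g s + h s)"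
proof -
  have "kclass i g \<otimes>\<^bsub>K i\<^esub> kclass i h = kcoset i (kfrag i g + kfrag i h)"
    unfolding kclass_def by (rule mult_K[OF keys_kfrag keys_kfrag])
  also have "\<dots> = kclass i (\<lambda>s. g s + h s)"
    unfolding kclass_def using kfrag_add by (subst eq_commute) (simp add: kcoset_eq_iff)
  finally show ?thesis .
qed

lemma kclass_cong:
  "(\<And>s. s \<in> degree_words i \<Longrightarrow> aclass (g s) = aclass (h s)) \<Longrightarrow> kclass i g = kclass i h"
  unfolding kclass_def kfrag_def by (auto intro!: arg_cong[where f = "kcoset i"] sum.cong)

lemma frag_zero_left:
  assumes "w \<in> carrier (W i)" shows "frag_of (aclass 0, w) \<in> kernelT i"
proof -
  interpret tensor_pair A "W i" by (rule tensor_pair_koszul)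
  show ?thesis by (rule TK_zero_left[OF _ assms]) (simp_all add: aclass_add)
qed

lemma kclass_zero: "kclass i (\<lambda>s. 0) = \<one>\<^bsub>K i\<^esub>"
proof -
  interpret tensor_pair A "W i" by (rule tensor_pair_koszul)
  have "kfrag i (\<lambda>s. 0) \<in> kernelT i"
    unfolding kfrag_def by (intro TK_sum frag_zero_left word_in_W)
  then show ?thesis by (simp add: kclass_def one_K kcoset_eq_iff)
qed

text \<open>A coordinate of an element of \<open>K\<^sub>i\<close> is the product of a coordinate on \<open>A\<close> at a normal word and
  a coordinate on \<open>W\<close>; both factors are read off from an arbitrary representative.\<close>

lemma kclass_eq_iff:
  assumes g: "\<And>s. g s \<in> polys" and h: "\<And>s. h s \<in> polys"
  shows "kclass i g = kclass i h \<longleftrightarrow> (\<forall>s\<in>degree_words i. aclass (g s) = aclass (h s))"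
proof (intro iffI ballI)
  assume eq: "kclass i g = kclass i h"
  fix s assume s: "s \<in> degree_words i"
  then have sB: "s \<in> lists B" using degree_words_subset by blast
  interpret tensor_pair A "W i" by (rule tensor_pair_koszul)
  have "Poly_Mapping.lookup (g s) w = Poly_Mapping.lookup (h s) w" if w: "normal_word w" for w
  proof -
    \<comment> \<open>\<open>ca\<close> and \<open>ct\<close> are the coordinates on \<open>A\<close> and on \<open>W\<close>; their product is biadditive and balanced.\<close>
    define ca where "ca a = Poly_Mapping.lookup (SOME p. p \<in> polys \<and> aclass p = a) w" for a
    define ct where "ct t = Poly_Mapping.lookup (SOME p. p \<in> polys \<and> tclass p = t) s" for t
    have ca: "ca (aclass p) = Poly_Mapping.lookup p w" if "p \<in> polys" for p
    proof -
      have "(SOME q. q \<in> polys \<and> aclass q = aclass p) \<in> polys \<and>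
        aclass (SOME q. q \<in> polys \<and> aclass q = aclass p) = aclass p"
        by (rule someI[of "\<lambda>q. q \<in> polys \<and> aclass q = aclass p" p]) (use that in simp)
      with that w show ?thesis unfolding ca_def using aclass_eq_iff by blast
    qed
    have ct: "ct (tclass p) = Poly_Mapping.lookup p s" if "p \<in> polys" for p
    proof -
      have "(SOME q. q \<in> polys \<and> tclass q = tclass p) \<in> polys \<and>
        tclass (SOME q. q \<in> polys \<and> tclass q = tclass p) = tclass p"
        by (rule someI[of "\<lambda>q. q \<in> polys \<and> tclass q = tclass p" p]) (use that in simp)
      with that have "(SOME q. q \<in> polys \<and> tclass q = tclass p) = p" using tclass_inject by blast
      then show ?thesis by (simp add: ct_def)
    qed
    have Wpoly: "\<exists>q\<in>polys. t = tclass q" if "t \<in> carrier (W i)" for t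
      using W_representative[OF that] degree_words_subset[of i] by blast
    have Apoly: "\<exists>q\<in>polys. a = aclass q" if "a \<in> carrier A" for a
      using that by (auto simp: carrier_A)
    obtain E :: "_ \<Rightarrow> 'k" where E: "\<And>z z'. E (z + z') = E z + E z'"
        "\<And>x. E (frag_of x) = ca (fst x) * ct (snd x)" "\<And>z. z \<in> kernelT i \<Longrightarrow> E z = 0"
    proof (rule tensor_functional[of "\<lambda>x. ca (fst x) * ct (snd x)"])
      fix a a' t assume "a \<in> carrier A" "a' \<in> carrier A" "t \<in> carrier (W i)"
      then obtain p p' where "p \<in> polys" "a = aclass p" "p' \<in> polys" "a' = aclass p'" using Apoly by metis
      then show "ca (fst (a \<oplus>\<^bsub>A\<^esub> a', t)) * ct (snd (a \<oplus>\<^bsub>A\<^esub> a', t)) =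
          ca (fst (a, t)) * ct (snd (a, t)) + ca (fst (a', t)) * ct (snd (a', t))"
        using polys_add[of p p'] ca by (simp add: aclass_add lookup_add distrib_right)
    next
      fix a t t' assume "a \<in> carrier A" "t \<in> carrier (W i)" "t' \<in> carrier (W i)"
      then obtain p p' where "p \<in> polys" "t = tclass p" "p' \<in> polys" "t' = tclass p'" using Wpoly by metis
      then show "ca (fst (a, t \<oplus>\<^bsub>W i\<^esub> t')) * ct (snd (a, t \<oplus>\<^bsub>W i\<^esub> t')) =
          ca (fst (a, t)) * ct (snd (a, t)) + ca (fst (a, t')) * ct (snd (a, t'))"
        using polys_add[of p p'] ct by (simp add: W_simps tclass_add lookup_add distrib_left)
    next
      fix c a t assume "a \<in> carrier A" "t \<in> carrier (W i)"
      then obtain p q where "p \<in> polys" "a = aclass p" "q \<in> polys" "t = tclass q" using Apoly Wpoly by metis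
      then show "ca (fst (c \<odot>\<^bsub>A\<^esub> a, t)) * ct (snd (c \<odot>\<^bsub>A\<^esub> a, t)) =
          ca (fst (a, c \<odot>\<^bsub>W i\<^esub> t)) * ct (snd (a, c \<odot>\<^bsub>W i\<^esub> t))"
        using polys_map[of p c] polys_map[of q c] ca ct
        by (simp add: W_simps tclass_smult aclass_smult lookup_map_mult)
    qed blast
    have E0: "E 0 = 0" by (rule E(3)[OF TK_zero])
    have Esum: "E (sum z J) = (\<Sum>j\<in>J. E (z j))" for z and J :: "'v list set"
      by (induction J rule: infinite_finite_induct) (auto simp: E0 E(1))
    have Ek: "E (kfrag i g) = Poly_Mapping.lookup (g s) w" if "\<And>s. g s \<in> polys" for g
    proof -
      have "E (kfrag i g) = (\<Sum>s'\<in>degree_words i. Poly_Mapping.lookup (g s') w * ct (tclass (Poly_Mapping.single s' 1)))"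
        using ca that by (simp add: kfrag_def Esum E(2))
      also have "\<dots> = (\<Sum>s'\<in>degree_words i. if s' = s then Poly_Mapping.lookup (g s) w else 0)"
      proof (rule sum.cong)
        fix s' assume "s' \<in> degree_words i"
        then have "Poly_Mapping.single s' 1 \<in> polys" using degree_words_subset polys_single by blast
        from ct[OF this] show "Poly_Mapping.lookup (g s') w * ct (tclass (Poly_Mapping.single s' 1)) =
            (if s' = s then Poly_Mapping.lookup (g s) w else 0)"
          by (simp add: lookup_single when_def)
      qed simp
      also have "\<dots> = Poly_Mapping.lookup (g s) w" using s finite_degree_words by simp
      finally show ?thesis .
    qed
    have "E (kfrag i g - kfrag i h) = 0"
      using eq E(3) by (simp add: kclass_def kcoset_eq_iff)
    then show ?thesis
      using E(1)[of "kfrag i g - kfrag i h" "kfrag i h"] Ek[OF g] Ek[OF h] by simp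
  qed
  then show "aclass (g s) = aclass (h s)"
    using g[of s] h[of s] by (simp add: aclass_eq_iff)
qed (rule kclass_cong, simp)

text \<open>Expanding the second factor in the basis words and moving the scalars to the first one.\<close>

lemma kcoset_elt:
  assumes "Poly_Mapping.keys q \<subseteq> degree_words i"
  shows "kcoset i (frag_of (aclass p, tclass q)) =
    kclass i (\<lambda>s. Poly_Mapping.map ((*) (Poly_Mapping.lookup q s)) p)"
proof -
  interpret tensor_pair A "W i" by (rule tensor_pair_koszul)
  have map0: "Poly_Mapping.map ((*) (0::'k)) p = 0"
    by (intro poly_mapping_eqI) (simp add: lookup_map_mult)
  have "Poly_Mapping.keys q \<subseteq> degree_words i \<and> kcoset i (frag_of (aclass p, tclass q)) =
    kclass i (\<lambda>s. Poly_Mapping.map ((*) (Poly_Mapping.lookup q s)) p)"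
    using assms
  proof (induction q rule: poly_mapping_single_induct)
    case zero
    have "tclass 0 \<in> carrier (W i)" unfolding W_simps by (rule tclass_in_word_span) simp
    then have "frag_of (aclass p, tclass 0) \<in> kernelT i"
      by (intro TK_zero_right) (simp_all add: W_simps tclass_add)
    then have "kcoset i (frag_of (aclass p, tclass 0)) = kclass i (\<lambda>s. 0)"
      by (simp add: kclass_zero one_K kcoset_eq_iff)
    then show ?case by (simp only: lookup_zero map0) simp
  next
    case (single k c)
    have "kcoset i (frag_of (aclass p, tclass (Poly_Mapping.single k c))) =
        kcoset i (frag_of (aclass (Poly_Mapping.map ((*) c) p), tclass (Poly_Mapping.single k 1)))"
      using TK_smult[of "aclass p" "tclass (Poly_Mapping.single k 1)" c] word_in_W[OF single, of 1]
      by (subst eq_commute) (simp add: kcoset_eq_iff aclass_smult W_simps tclass_smult)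
    also have "\<dots> = kclass i (\<lambda>s. Poly_Mapping.map ((*) (Poly_Mapping.lookup (Poly_Mapping.single k c) s)) p)"
    proof -
      have coeffs: "Poly_Mapping.map ((*) (Poly_Mapping.lookup (Poly_Mapping.single k c) s)) p =
          (if s = k then Poly_Mapping.map ((*) c) p else 0)" for s
        by (intro poly_mapping_eqI) (simp add: lookup_map_mult lookup_single when_def)
      have "kfrag i (\<lambda>s. Poly_Mapping.map ((*) (Poly_Mapping.lookup (Poly_Mapping.single k c) s)) p) =
        frag_of (aclass (Poly_Mapping.map ((*) c) p), tclass (Poly_Mapping.single k 1)) +
        (\<Sum>s\<in>degree_words i - {k}. frag_of (aclass 0, tclass (Poly_Mapping.single s 1)))"
        unfolding kfrag_def coeffs by (subst sum.remove[OF finite_degree_words single]) simp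
      moreover have "(\<Sum>s\<in>degree_words i - {k}. frag_of (aclass 0, tclass (Poly_Mapping.single s 1))) \<in> kernelT i"
        by (intro TK_sum frag_zero_left word_in_W) simp
      ultimately show ?thesis
        unfolding kclass_def by (subst eq_commute) (simp add: kcoset_eq_iff)
    qed
    finally show ?case using single by simp
  next
    case (add q q')
    have map_add: "Poly_Mapping.map ((*) (a + b)) p = Poly_Mapping.map ((*) a) p + Poly_Mapping.map ((*) b) p" for a b
      by (intro poly_mapping_eqI) (simp add: lookup_map_mult lookup_add distrib_right)
    have W: "tclass q \<in> carrier (W i)" "tclass q' \<in> carrier (W i)"
      unfolding W_simps using add by (auto intro: tclass_in_word_span)
    have "kcoset i (frag_of (aclass p, tclass (q + q'))) =
      kcoset i (frag_of (aclass p, tclass q) + frag_of (aclass p, tclass q'))"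
      using TK_add_right[OF _ W, of "aclass p"] by (simp add: W_simps tclass_add kcoset_eq_iff)
    also have "\<dots> = kcoset i (frag_of (aclass p, tclass q)) \<otimes>\<^bsub>K i\<^esub> kcoset i (frag_of (aclass p, tclass q'))"
      using W by (subst mult_K) auto
    also have "\<dots> = kclass i (\<lambda>s. Poly_Mapping.map ((*) (Poly_Mapping.lookup (q + q') s)) p)"
      using add by (simp add: kclass_add lookup_add map_add)
    finally show ?case using add keys_add[of q q'] by blast
  qed
  then show ?thesis ..
qed

lemma tensor_elt_kclass:
  assumes "Poly_Mapping.keys q \<subseteq> degree_words i"
  shows "tensor_elt A (W i) (aclass p) (tclass q) =
    kclass i (\<lambda>s. Poly_Mapping.map ((*) (Poly_Mapping.lookup q s)) p)"
  using kcoset_elt[OF assms] tensor_pair.tensor_elt_eq[OF tensor_pair_koszul]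
  by (simp add: kcoset_def)

lemma kclass_in_carrier [simp]: "kclass i g \<in> carrier (K i)"
  unfolding K_eq tensor_pair.carrier_tensor_product[OF tensor_pair_koszul] kclass_def kcoset_def
  using keys_kfrag by blast

lemma carrier_K: "carrier (K i) = kclass i ` {g. \<forall>s. g s \<in> polys}"
proof
  show "carrier (K i) \<subseteq> kclass i ` {g. \<forall>s. g s \<in> polys}"
  proof
    fix X assume "X \<in> carrier (K i)"
    then obtain z where z: "Poly_Mapping.keys z \<subseteq> carrier A \<times> carrier (W i)" "X = kcoset i z"
      unfolding K_eq tensor_pair.carrier_tensor_product[OF tensor_pair_koszul] kcoset_def by blast
    have "\<exists>g. (\<forall>s. g s \<in> polys) \<and> kcoset i z = kclass i g"
      using z(1)
    proof (induction z rule: frag_induction)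
      case zero
      then show ?case by (intro exI[of _ "\<lambda>s. 0"]) (simp add: kclass_zero one_K)
    next
      case (one x)
      then obtain p q where x: "x = (aclass p, tclass q)" "p \<in> polys" "Poly_Mapping.keys q \<subseteq> degree_words i"
        using W_representative unfolding carrier_A by blast
      show ?case unfolding x(1) kcoset_elt[OF x(3)]
        by (rule exI[of _ "\<lambda>s. Poly_Mapping.map ((*) (Poly_Mapping.lookup q s)) p"])
           (simp only: polys_map[OF x(2)] simp_thms)
    next
      case (diff a b)
      then obtain g h where g: "\<forall>s. g s \<in> polys" "kcoset i a = kclass i g"
        and h: "\<forall>s. h s \<in> polys" "kcoset i b = kclass i h" by blast
      interpret tensor_pair A "W i" by (rule tensor_pair_koszul)
      have ab: "a - kfrag i g \<in> kernelT i" "b - kfrag i h \<in> kernelT i"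
        using g h by (simp_all add: kclass_def kcoset_eq_iff)
      have gh: "kfrag i g - (kfrag i (\<lambda>s. g s - h s) + kfrag i h) \<in> kernelT i"
        using kfrag_add[of i "\<lambda>s. g s - h s" h] by simp
      have "a - kfrag i g + (kfrag i g - (kfrag i (\<lambda>s. g s - h s) + kfrag i h)) - (b - kfrag i h) \<in> kernelT i"
        by (rule TK_diff[OF TK_add[OF ab(1) gh] ab(2)])
      then have "kcoset i (a - b) = kclass i (\<lambda>s. g s - h s)"
        by (simp add: kclass_def kcoset_eq_iff algebra_simps)
      moreover have "\<forall>s. g s - h s \<in> polys"
        using g(1) h(1) by (intro allI polys_diff) simp_all
      ultimately show ?case by (intro exI[of _ "\<lambda>s. g s - h s"]) simp
    qed
    with z(2) show "X \<in> kclass i ` {g. \<forall>s. g s \<in> polys}" by blast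
  qed
qed auto

section \<open>The differential in coordinates\<close>

definition step :: "nat \<Rightarrow> nat" where
  "step i = jump N i - jump N (i - 1)"

lemma step_eq: "i > 0 \<Longrightarrow> step i = (if even i then N - 1 else 1)"
  using length_f by (auto simp: step_def jump_def elim!: evenE oddE)
    (cases "i div 2"; auto simp: algebra_simps)

lemma jump_step: "i > 0 \<Longrightarrow> jump N i = step i + jump N (i - 1)"
  using length_f by (auto simp: step_def jump_def elim!: evenE oddE)
    (cases "i div 2"; auto simp: algebra_simps)

lemma degree_words_split:
  assumes "i > 0" "s \<in> degree_words i"
  shows take_degree_words: "take (step i) s \<in> words (step i)"
    and drop_degree_words: "drop (step i) s \<in> degree_words (i - 1)"
    and length_degree_words: "length s = step i + jump N (i - 1)"
proof -
  have s: "s \<in> words (jump N i)" using assms(2) by (simp add: degree_words_def koszul_words_def)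
  then show len: "length s = step i + jump N (i - 1)"
    using jump_step[OF assms(1)] by (simp add: words_def)
  then show "take (step i) s \<in> words (step i)" 
    using s by (auto simp: words_def dest: in_set_takeD)
  have "drop (step i) s \<in> koszul_words (length (drop (step i) s))"
    using assms(2) by (intro koszul_words_sublist[OF _ sublist_drop]) (simp add: degree_words_def)
  then show "drop (step i) s \<in> degree_words (i - 1)"
    using len by (simp add: degree_words_def)
qed

text \<open>The coordinates of the image under the differential: \<open>a \<otimes> u s'\<close>, with \<open>u\<close> of length
  \<open>step i\<close>, contributes \<open>a u\<close> at \<open>s'\<close>.\<close>

definition dpoly :: "nat \<Rightarrow> ('v list \<Rightarrow> ('v list \<Rightarrow>\<^sub>0 'k)) \<Rightarrow> 'v list \<Rightarrow> ('v list \<Rightarrow>\<^sub>0 'k)" where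
  "dpoly i g s' = (\<Sum>s | s \<in> degree_words i \<and> drop (step i) s = s'.
     g s * Poly_Mapping.single (take (step i) s) 1)"

lemma take_word: "s \<in> lists B \<Longrightarrow> take n s \<in> lists B"
  by (auto dest: in_set_takeD)

lemma degree_word: "s \<in> degree_words i \<Longrightarrow> s \<in> lists B"
  using degree_words_subset by blast

lemma dpoly_polys: "(\<And>s. g s \<in> polys) \<Longrightarrow> dpoly i g s' \<in> polys"
  unfolding dpoly_def
  by (intro polys_sum polys_mult polys_single take_word degree_word[of _ i]) auto

lemma dpoly_add: "dpoly i (\<lambda>s. g s + h s) s' = dpoly i g s' + dpoly i h s'"
  by (simp add: dpoly_def distrib_right sum.distrib)

lemma aclass_sum_cong:
  "(\<And>j. j \<in> J \<Longrightarrow> aclass (p j) = aclass (q j)) \<Longrightarrow> aclass (sum p J) = aclass (sum q J)"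
  by (induction J rule: infinite_finite_induct) (auto simp flip: aclass_add)

lemma dpoly_cong:
  assumes "\<And>s. s \<in> degree_words i \<Longrightarrow> aclass (g s) = aclass (h s)"
  shows "aclass (dpoly i g s') = aclass (dpoly i h s')"
  unfolding dpoly_def using assms by (intro aclass_sum_cong) (simp flip: aclass_mult)

text \<open>All words \<open>u\<close> that are moved to the left have the same length, so \<open>w u\<close> determines \<open>w\<close> and
  \<open>u\<close>, and each coefficient of the image comes from a single coefficient.\<close>

lemma lookup_dpoly:
  "Poly_Mapping.lookup (dpoly i g s') (w @ u) =
    (if u @ s' \<in> degree_words i then Poly_Mapping.lookup (g (u @ s')) w else 0)"
  if "length u = step i" "i > 0"
proof -
  have "Poly_Mapping.lookup (g s * Poly_Mapping.single (take (step i) s) 1) (w @ u) =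
    (if s = u @ s' then Poly_Mapping.lookup (g (u @ s')) w else 0)"
    if s: "s \<in> degree_words i" "drop (step i) s = s'" for s
  proof (cases "take (step i) s = u")
    case True
    then have "s = u @ s'" using s(2) by (metis append_take_drop_id)
    with True show ?thesis by (simp add: lookup_mult_word)
  next
    case False
    then have "s \<noteq> u @ s'" using \<open>length u = step i\<close> by auto
    moreover have "length (take (step i) s) = step i"
      using take_degree_words[OF \<open>i > 0\<close> s(1)] by (simp add: words_def)
    then have "\<not> suffix (take (step i) s) (w @ u)"
      using False \<open>length u = step i\<close> by (auto simp: suffix_def)
    ultimately show ?thesis by (simp add: lookup_mult_word_not_suffix)
  qed
  then have "Poly_Mapping.lookup (dpoly i g s') (w @ u) =
    (\<Sum>s | s \<in> degree_words i \<and> drop (step i) s = s'. if s = u @ s' then Poly_Mapping.lookup (g (u @ s')) w else 0)"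
    unfolding dpoly_def lookup_sum by (intro sum.cong) auto
  also have "\<dots> = (if u @ s' \<in> degree_words i then Poly_Mapping.lookup (g (u @ s')) w else 0)"
    using finite_degree_words[of i] \<open>length u = step i\<close> by (simp add: sum.delta)
  finally show ?thesis .
qed

lemma lookup_dpoly_short:
  assumes "length v < step i" "i > 0"
  shows "Poly_Mapping.lookup (dpoly i g s') v = 0"
proof -
  have "\<not> suffix (take (step i) s) v" if "s \<in> degree_words i" for s
    using take_degree_words[OF assms(2) that] assms(1) suffix_length_le by (fastforce simp: words_def)
  then show ?thesis
    unfolding dpoly_def lookup_sum by (intro sum.neutral) (auto intro: lookup_mult_word_not_suffix)
qed

text \<open>The differential in coordinates. The choice of the representative \<open>g\<close> does not matter by
  \<open>kclass_eq_iff\<close> and \<open>dpoly_cong\<close>.\<close>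

definition dmap where
  "dmap i = (\<lambda>z\<in>carrier (K i).
     kclass (i - 1) (dpoly i (SOME g. (\<forall>s. g s \<in> polys) \<and> z = kclass i g)))"

lemma dmap_kclass:
  assumes "i > 0" "\<And>s. g s \<in> polys"
  shows "dmap i (kclass i g) = kclass (i - 1) (dpoly i g)"
proof -
  let ?h = "SOME h. (\<forall>s. h s \<in> polys) \<and> kclass i g = kclass i h"
  have h: "(\<forall>s. ?h s \<in> polys) \<and> kclass i g = kclass i ?h"
    by (rule someI[of "\<lambda>h. (\<forall>s. h s \<in> polys) \<and> kclass i g = kclass i h" g]) (use assms(2) in simp)
  then have eq: "aclass (g s) = aclass (?h s)" if "s \<in> degree_words i" for s
    using kclass_eq_iff[of g ?h i] assms(2) that by blast
  have "kclass (i - 1) (dpoly i g) = kclass (i - 1) (dpoly i ?h)"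
    by (rule kclass_cong, rule dpoly_cong, rule eq)
  then show ?thesis by (simp add: dmap_def)
qed

lemma finsum_tclass: "(\<Oplus>\<^bsub>T\<^esub>j\<in>{..<l::nat}. tclass (p j)) = tclass (\<Sum>j<l. p j)"
proof -
  interpret ring T by (rule ring_T)
  show ?thesis
  proof (induction l)
    case (Suc l)
    have "(\<Oplus>\<^bsub>T\<^esub>j\<in>insert l {..<l}. tclass (p j)) = tclass (p l) \<oplus>\<^bsub>T\<^esub> (\<Oplus>\<^bsub>T\<^esub>j\<in>{..<l}. tclass (p j))"
      by (rule finsum_insert) auto
    with Suc show ?case by (simp add: lessThan_Suc tclass_add)
  qed (simp add: tclass_zero)
qed

lemma finprod_kclass: "(\<Otimes>\<^bsub>K i\<^esub>j\<in>{..<l::nat}. kclass i (g j)) = kclass i (\<lambda>s. \<Sum>j<l. g j s)"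
proof -
  interpret comm_group "K i" by (rule comm_group_K)
  show ?thesis
  proof (induction l)
    case (Suc l)
    have "(\<Otimes>\<^bsub>K i\<^esub>j\<in>insert l {..<l}. kclass i (g j)) = kclass i (g l) \<otimes>\<^bsub>K i\<^esub> (\<Otimes>\<^bsub>K i\<^esub>j\<in>{..<l}. kclass i (g j))"
      by (rule finprod_insert) auto
    with Suc show ?case by (simp add: lessThan_Suc kclass_add)
  qed (simp add: kclass_zero)
qed

text \<open>The characterization of the map that is selected in the definition of the Koszul differential.\<close>

definition is_differential where
  "is_differential i d \<longleftrightarrow>
     d \<in> hom (K i) (K (i - 1)) \<inter> extensional (carrier (K i)) \<and>
     (\<forall>a \<in> carrier A. \<forall>(l::nat) u w.
        u \<in> {..<l} \<rightarrow> tensor_power scale (step i) \<longrightarrow>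
        w \<in> {..<l} \<rightarrow> carrier (W (i - 1)) \<longrightarrow>
        (\<Oplus>\<^bsub>T\<^esub>j\<in>{..<l}. u j \<otimes>\<^bsub>T\<^esub> w j) \<in> carrier (W i) \<longrightarrow>
        d (tensor_elt A (W i) a (\<Oplus>\<^bsub>T\<^esub>j\<in>{..<l}. u j \<otimes>\<^bsub>T\<^esub> w j)) =
          (\<Otimes>\<^bsub>K (i - 1)\<^esub>j\<in>{..<l}. tensor_elt A (W (i - 1)) (a \<otimes>\<^bsub>A\<^esub> algebra_class scale R (u j)) (w j)))"

lemma koszul_diff_eq: "koszul_diff scale N R i = (THE d. is_differential i d)"
  by (simp only: koszul_diff_def is_differential_def Let_def step_def)

lemma dmap_hom:
  assumes "i > 0"
  shows "dmap i \<in> hom (K i) (K (i - 1))"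
proof (rule homI)
  fix y z assume "y \<in> carrier (K i)" "z \<in> carrier (K i)"
  then obtain g h where g: "\<And>s. g s \<in> polys" "y = kclass i g" and h: "\<And>s. h s \<in> polys" "z = kclass i h"
    unfolding carrier_K by blast
  have gh: "\<And>s. g s + h s \<in> polys" by (rule polys_add[OF g(1) h(1)])
  show "dmap i (y \<otimes>\<^bsub>K i\<^esub> z) = dmap i y \<otimes>\<^bsub>K (i - 1)\<^esub> dmap i z"
    unfolding g(2) h(2) kclass_add dmap_kclass[OF assms gh] dmap_kclass[OF assms g(1)] dmap_kclass[OF assms h(1)]
    by (simp add: dpoly_add[abs_def])
next
  fix y assume "y \<in> carrier (K i)"
  then show "dmap i y \<in> carrier (K (i - 1))" by (simp add: dmap_def)
qed

lemma map_mult_left: "Poly_Mapping.map ((*) c) p * q = Poly_Mapping.map ((*) c) (p * q)" for c :: 'k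
  by (simp add: mult_map_scale_conv_mult mult.assoc)

lemma map_mult_right: "p * Poly_Mapping.map ((*) c) q = Poly_Mapping.map ((*) c) (p * q)" for c :: 'k
proof -
  have comm: "p * Poly_Mapping.single 0 c = Poly_Mapping.single 0 c * p"
    using subset_UNIV[of "Poly_Mapping.keys p"]
    by (induction p rule: poly_mapping_single_induct) (auto simp: mult_single algebra_simps)
  show ?thesis by (simp add: mult_map_scale_conv_mult comm flip: mult.assoc)
qed

text \<open>The formula holds because the coefficient of \<open>\<Sum>\<^sub>j u\<^sub>j w\<^sub>j\<close> at a word \<open>x s'\<close>,
  with \<open>x\<close> of the degree of the \<open>u\<^sub>j\<close>, is the sum of the products of the coefficients of
  \<open>u\<^sub>j\<close> at \<open>x\<close> and of \<open>w\<^sub>j\<close> at \<open>s'\<close>.\<close>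

lemma dmap_formula:
  fixes l :: nat
  assumes i: "i > 0" and a: "a \<in> carrier A"
    and u: "u \<in> {..<l} \<rightarrow> tensor_power scale (step i)"
    and w: "w \<in> {..<l} \<rightarrow> carrier (W (i - 1))"
    and uw: "(\<Oplus>\<^bsub>T\<^esub>j\<in>{..<l}. u j \<otimes>\<^bsub>T\<^esub> w j) \<in> carrier (W i)"
  shows "dmap i (tensor_elt A (W i) a (\<Oplus>\<^bsub>T\<^esub>j\<in>{..<l}. u j \<otimes>\<^bsub>T\<^esub> w j)) =
    (\<Otimes>\<^bsub>K (i - 1)\<^esub>j\<in>{..<l}. tensor_elt A (W (i - 1)) (a \<otimes>\<^bsub>A\<^esub> algebra_class scale R (u j)) (w j))"
proof -
  interpret T: ring T by (rule ring_T)
  interpret K': comm_group "K (i - 1)" by (rule comm_group_K)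
  obtain p where p: "p \<in> polys" "a = aclass p" using a by (auto simp: carrier_A)
  have "\<forall>j\<in>{..<l}. \<exists>q. Poly_Mapping.keys q \<subseteq> words (step i) \<and> u j = tclass q"
    using u unfolding tensor_power_eq by (auto simp: word_span_def Pi_iff image_iff)
  then obtain U where U: "\<And>j. j < l \<Longrightarrow> Poly_Mapping.keys (U j) \<subseteq> words (step i)" "\<And>j. j < l \<Longrightarrow> u j = tclass (U j)"
    by (metis lessThan_iff)
  have "\<forall>j\<in>{..<l}. \<exists>q. Poly_Mapping.keys q \<subseteq> degree_words (i - 1) \<and> w j = tclass q"
    using w W_representative by blast
  then obtain V where V: "\<And>j. j < l \<Longrightarrow> Poly_Mapping.keys (V j) \<subseteq> degree_words (i - 1)" "\<And>j. j < l \<Longrightarrow> w j = tclass (V j)"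
    by (metis lessThan_iff)
  define Q where "Q = (\<Sum>j<l. U j * V j)"
  have Qsum: "(\<Oplus>\<^bsub>T\<^esub>j\<in>{..<l}. u j \<otimes>\<^bsub>T\<^esub> w j) = tclass Q"
  proof -
    have "(\<Oplus>\<^bsub>T\<^esub>j\<in>{..<l}. u j \<otimes>\<^bsub>T\<^esub> w j) = (\<Oplus>\<^bsub>T\<^esub>j\<in>{..<l}. tclass (U j * V j))"
      by (rule T.finsum_cong') (auto simp: U V tclass_mult)
    then show ?thesis by (simp add: finsum_tclass Q_def)
  qed
  have UV: "U j \<in> polys" "V j \<in> polys" if "j < l" for j
    using U(1)[OF that] V(1)[OF that] words_subset_lists degree_words_subset by blast+
  have "Q \<in> polys" unfolding Q_def by (intro polys_sum polys_mult UV) auto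
  then have Q: "Poly_Mapping.keys Q \<subseteq> degree_words i"
    using uw tclass_in_word_span_iff[OF _ degree_words_subset] unfolding Qsum W_simps by blast
  have coeff: "(\<Sum>s | s \<in> degree_words i \<and> drop (step i) s = s'.
        Poly_Mapping.single (take (step i) s) (Poly_Mapping.lookup Q s)) =
      (\<Sum>j<l. Poly_Mapping.map ((*) (Poly_Mapping.lookup (V j) s')) (U j))" (is "?L = ?M") for s'
  proof (rule poly_mapping_eqI)
    fix x
    have L: "Poly_Mapping.lookup ?L x = (\<Sum>s | s \<in> degree_words i \<and> drop (step i) s = s'.
        if take (step i) s = x then Poly_Mapping.lookup Q s else 0)"
      by (simp add: lookup_sum lookup_single when_def)
    have M: "Poly_Mapping.lookup ?M x = (\<Sum>j<l. Poly_Mapping.lookup (V j) s' * Poly_Mapping.lookup (U j) x)"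
      by (simp add: lookup_sum lookup_map_mult)
    show "Poly_Mapping.lookup ?L x = Poly_Mapping.lookup ?M x"
    proof (cases "x \<in> words (step i)")
      case True
      then have len: "length x = step i" by (simp add: words_def)
      have "Poly_Mapping.lookup ?L x = (\<Sum>s | s \<in> degree_words i \<and> drop (step i) s = s'.
        if s = x @ s' then Poly_Mapping.lookup Q (x @ s') else 0)"
        unfolding L
      proof (rule sum.cong)
        fix s assume "s \<in> {s. s \<in> degree_words i \<and> drop (step i) s = s'}"
        then have "s = x @ s' \<longleftrightarrow> take (step i) s = x"
          using len by (metis (mono_tags, lifting) append_eq_conv_conj mem_Collect_eq)
        then show "(if take (step i) s = x then Poly_Mapping.lookup Q s else 0) =
            (if s = x @ s' then Poly_Mapping.lookup Q (x @ s') else 0)" by auto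
      qed simp
      also have "\<dots> = (if x @ s' \<in> degree_words i then Poly_Mapping.lookup Q (x @ s') else 0)"
        using finite_degree_words[of i] len by (simp add: sum.delta)
      also have "\<dots> = Poly_Mapping.lookup Q (x @ s')"
        using Q by (auto simp: in_keys_iff subset_iff)
      also have "\<dots> = (\<Sum>j<l. Poly_Mapping.lookup (U j) x * Poly_Mapping.lookup (V j) s')"
        unfolding Q_def lookup_sum
      proof (rule sum.cong)
        fix j assume "j \<in> {..<l}"
        then have "Poly_Mapping.keys (U j) \<subseteq> {u. length u = step i}" using U(1)[of j] by (auto simp: words_def)
        from lookup_mult_homogeneous_left[OF this len]
        show "Poly_Mapping.lookup (U j * V j) (x @ s') = Poly_Mapping.lookup (U j) x * Poly_Mapping.lookup (V j) s'" .
      qed simp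
      finally show ?thesis unfolding M by (simp add: mult.commute)
    next
      case False
      then have "Poly_Mapping.lookup ?L x = 0"
        unfolding L using take_degree_words[OF i] by (intro sum.neutral) auto
      moreover have "Poly_Mapping.lookup (U j) x = 0" if "j < l" for j
        using False U(1)[OF that] by (auto simp: in_keys_iff subset_iff)
      ultimately show ?thesis unfolding M by simp
    qed
  qed
  have "dmap i (tensor_elt A (W i) a (\<Oplus>\<^bsub>T\<^esub>j\<in>{..<l}. u j \<otimes>\<^bsub>T\<^esub> w j)) =
    dmap i (kclass i (\<lambda>s. Poly_Mapping.map ((*) (Poly_Mapping.lookup Q s)) p))"
    unfolding Qsum p(2) tensor_elt_kclass[OF Q] ..
  also have "\<dots> = kclass (i - 1) (dpoly i (\<lambda>s. Poly_Mapping.map ((*) (Poly_Mapping.lookup Q s)) p))"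
    by (rule dmap_kclass[OF i polys_map[OF p(1)]])
  also have "dpoly i (\<lambda>s. Poly_Mapping.map ((*) (Poly_Mapping.lookup Q s)) p) =
    (\<lambda>s'. \<Sum>j<l. Poly_Mapping.map ((*) (Poly_Mapping.lookup (V j) s')) (p * U j))"
  proof
    fix s'
    have "dpoly i (\<lambda>s. Poly_Mapping.map ((*) (Poly_Mapping.lookup Q s)) p) s' =
      p * (\<Sum>s | s \<in> degree_words i \<and> drop (step i) s = s'.
        Poly_Mapping.single (take (step i) s) (Poly_Mapping.lookup Q s))"
      by (simp add: dpoly_def sum_distrib_left map_mult_left flip: map_mult_right)
    also have "\<dots> = (\<Sum>j<l. Poly_Mapping.map ((*) (Poly_Mapping.lookup (V j) s')) (p * U j))"
      unfolding coeff by (simp add: sum_distrib_left map_mult_right)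
    finally show "dpoly i (\<lambda>s. Poly_Mapping.map ((*) (Poly_Mapping.lookup Q s)) p) s' = \<dots>" .
  qed
  also have "kclass (i - 1) \<dots> =
    (\<Otimes>\<^bsub>K (i - 1)\<^esub>j\<in>{..<l}. kclass (i - 1) (\<lambda>s'. Poly_Mapping.map ((*) (Poly_Mapping.lookup (V j) s')) (p * U j)))"
    by (rule finprod_kclass[symmetric])
  also have "\<dots> = (\<Otimes>\<^bsub>K (i - 1)\<^esub>j\<in>{..<l}. tensor_elt A (W (i - 1)) (a \<otimes>\<^bsub>A\<^esub> algebra_class scale R (u j)) (w j))"
  proof (rule K'.finprod_cong')
    have elt: "tensor_elt A (W (i - 1)) (a \<otimes>\<^bsub>A\<^esub> algebra_class scale R (u j)) (w j) =
      kclass (i - 1) (\<lambda>s'. Poly_Mapping.map ((*) (Poly_Mapping.lookup (V j) s')) (p * U j))" if "j < l" for j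
      using tensor_elt_kclass[OF V(1)[OF that], of "p * U j"] that
      by (simp add: U V p(2) aclass_mult flip: aclass_def)
    show "(\<lambda>j. tensor_elt A (W (i - 1)) (a \<otimes>\<^bsub>A\<^esub> algebra_class scale R (u j)) (w j)) \<in> {..<l} \<rightarrow> carrier (K (i - 1))"
    proof
      fix j assume "j \<in> {..<l}"
      then show "tensor_elt A (W (i - 1)) (a \<otimes>\<^bsub>A\<^esub> algebra_class scale R (u j)) (w j) \<in> carrier (K (i - 1))"
        by (subst elt) (auto simp del: One_nat_def)
    qed
    show "kclass (i - 1) (\<lambda>s'. Poly_Mapping.map ((*) (Poly_Mapping.lookup (V j) s')) (p * U j)) =
      tensor_elt A (W (i - 1)) (a \<otimes>\<^bsub>A\<^esub> algebra_class scale R (u j)) (w j)" if "j \<in> {..<l}" for j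
      using that elt[of j] by (simp del: One_nat_def)
  qed simp
  finally show ?thesis .
qed

text \<open>Elementary tensors with a word in the second factor generate \<open>K\<^sub>i\<close>, so they determine a homomorphism.
  This is the uniqueness part of the definition of the differential.\<close>

lemma hom_eqI:
  assumes d: "d \<in> hom (K i) (K j)" "d' \<in> hom (K i) (K j)"
    and ext: "d \<in> extensional (carrier (K i))" "d' \<in> extensional (carrier (K i))"
    and eq: "\<And>p s. s \<in> degree_words i \<Longrightarrow>
      d (tensor_elt A (W i) (aclass p) (tclass (Poly_Mapping.single s 1))) =
      d' (tensor_elt A (W i) (aclass p) (tclass (Poly_Mapping.single s 1)))"
  shows "d = d'"
proof (rule extensionalityI[OF ext])
  fix z assume "z \<in> carrier (K i)"
  then obtain g where z: "z = kclass i g" by (auto simp: carrier_K)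
  interpret h: group_hom "K i" "K j" d
    using d(1) comm_group_K by (intro group_hom.intro group_hom_axioms.intro) (auto simp: comm_group_def)
  interpret h': group_hom "K i" "K j" d'
    using d(2) comm_group_K by (intro group_hom.intro group_hom_axioms.intro) (auto simp: comm_group_def)
  define x where "x s = frag_of (aclass (g s), tclass (Poly_Mapping.single s 1))" for s
  have x: "Poly_Mapping.keys (x s) \<subseteq> carrier A \<times> carrier (W i)" if "s \<in> degree_words i" for s
    using that by (auto simp: x_def intro: word_in_W)
  have "d (kcoset i (sum x F)) = d' (kcoset i (sum x F))" if "F \<subseteq> degree_words i" for F
    using finite_subset[OF that finite_degree_words] that
  proof (induction F rule: finite_induct)
    case empty
    show ?case using h.hom_one h'.hom_one by (simp add: one_K)
  next
    case (insert s F)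
    have keys: "Poly_Mapping.keys (sum x F) \<subseteq> carrier A \<times> carrier (W i)"
      using insert x by (intro keys_sum_subset) auto
    have car: "kcoset i z \<in> carrier (K i)" if "Poly_Mapping.keys z \<subseteq> carrier A \<times> carrier (W i)" for z
      using that unfolding K_eq tensor_pair.carrier_tensor_product[OF tensor_pair_koszul] kcoset_def by blast
    have split: "kcoset i (sum x (insert s F)) = kcoset i (x s) \<otimes>\<^bsub>K i\<^esub> kcoset i (sum x F)"
      using insert keys x by (subst mult_K) auto
    have "d (kcoset i (x s)) = d' (kcoset i (x s))"
      using eq[of s "g s"] insert tensor_pair.tensor_elt_eq[OF tensor_pair_koszul]
      by (simp add: x_def kcoset_def)
    then show ?case
      unfolding split using insert car[OF keys] car[OF x[of s]] by simp
  qed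
  from this[of "degree_words i"] show "d z = d' z"
    by (simp add: z kclass_def kfrag_def x_def)
qed

lemma koszul_diff_dmap:
  assumes i: "i > 0"
  shows "koszul_diff scale N R i = dmap i"
  unfolding koszul_diff_eq
proof (rule the_equality)
  show dmap: "is_differential i (dmap i)"
    unfolding is_differential_def using dmap_hom[OF i] dmap_formula[OF i]
    by (auto simp: dmap_def)
  fix d assume d: "is_differential i d"
  show "d = dmap i"
  proof (rule hom_eqI)
    fix p s assume s: "s \<in> degree_words i"
    \<comment> \<open>A basis word is a single product, so the formula with one summand determines \<open>d\<close>.\<close>
    define u where "u = (\<lambda>j::nat. tclass (Poly_Mapping.single (take (step i) s) 1))"
    define w where "w = (\<lambda>j::nat. tclass (Poly_Mapping.single (drop (step i) s) 1))"
    have sum: "(\<Oplus>\<^bsub>T\<^esub>j\<in>{..<1}. u j \<otimes>\<^bsub>T\<^esub> w j) = tclass (Poly_Mapping.single s 1)"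
      by (simp add: u_def w_def tclass_mult single_mult_single finsum_tclass[of _ 1, simplified])
    have u: "u \<in> {..<1} \<rightarrow> tensor_power scale (step i)"
      using take_degree_words[OF i s] by (auto simp: u_def tensor_power_eq intro: tclass_in_word_span)
    have w: "w \<in> {..<1} \<rightarrow> carrier (W (i - 1))"
      using word_in_W[OF drop_degree_words[OF i s]] by (auto simp: w_def)
    note formula = conjunct2[OF is_differential_def[THEN iffD1], rule_format,
        of i _ "aclass p" u 1 w, unfolded sum, OF _ aclass_in_carrier u w word_in_W[OF s]]
    show "d (tensor_elt A (W i) (aclass p) (tclass (Poly_Mapping.single s 1))) =
      dmap i (tensor_elt A (W i) (aclass p) (tclass (Poly_Mapping.single s 1)))"
      using formula[OF d] formula[OF dmap] by simp
  qed (use d dmap in \<open>auto simp: is_differential_def\<close>)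
qed

section \<open>Exactness in terms of words\<close>

text \<open>The coefficient of \<open>w\<close> in \<open>g(s)\<close> reappears as the coefficient of \<open>w u\<close> in the image, where
  \<open>s = u s'\<close>, without interference from other terms; it is lost exactly if \<open>w u\<close> is not normal.\<close>

lemma kclass_in_kernel_iff:
  assumes i: "i > 0" and g: "\<And>s. g s \<in> polys"
  shows "dmap i (kclass i g) = \<one>\<^bsub>K (i - 1)\<^esub> \<longleftrightarrow>
    (\<forall>s\<in>degree_words i. \<forall>w. normal_word (w @ take (step i) s) \<longrightarrow> Poly_Mapping.lookup (g s) w = 0)"
proof -
  have "dmap i (kclass i g) = \<one>\<^bsub>K (i - 1)\<^esub> \<longleftrightarrow> kclass (i - 1) (dpoly i g) = kclass (i - 1) (\<lambda>s. 0)"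
    by (simp add: dmap_kclass[OF i g] kclass_zero del: One_nat_def)
  also have "\<dots> \<longleftrightarrow> (\<forall>s'\<in>degree_words (i - 1). aclass (dpoly i g s') = aclass 0)"
    by (rule kclass_eq_iff) (simp_all add: dpoly_polys[OF g, simplified])
  also have "\<dots> \<longleftrightarrow> (\<forall>s'\<in>degree_words (i - 1). \<forall>v. normal_word v \<longrightarrow> Poly_Mapping.lookup (dpoly i g s') v = 0)"
    by (simp add: aclass_eq_iff[OF dpoly_polys[OF g, simplified]])
  also have "\<dots> \<longleftrightarrow>
    (\<forall>s\<in>degree_words i. \<forall>w. normal_word (w @ take (step i) s) \<longrightarrow> Poly_Mapping.lookup (g s) w = 0)"
  proof (intro iffI ballI allI impI)
    fix s w
    assume *: "\<forall>s'\<in>degree_words (i - 1). \<forall>v. normal_word v \<longrightarrow> Poly_Mapping.lookup (dpoly i g s') v = 0"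
      and s: "s \<in> degree_words i" and w: "normal_word (w @ take (step i) s)"
    have "Poly_Mapping.lookup (dpoly i g (drop (step i) s)) (w @ take (step i) s) = 0"
      using * drop_degree_words[OF i s] w by blast
    moreover have "length (take (step i) s) = step i"
      using take_degree_words[OF i s] by (simp add: words_def)
    ultimately show "Poly_Mapping.lookup (g s) w = 0"
      using lookup_dpoly[of "take (step i) s" i g "drop (step i) s" w] i s by simp
  next
    fix s' v
    assume *: "\<forall>s\<in>degree_words i. \<forall>w. normal_word (w @ take (step i) s) \<longrightarrow> Poly_Mapping.lookup (g s) w = 0"
      and v: "normal_word v"
    show "Poly_Mapping.lookup (dpoly i g s') v = 0"
    proof (cases "length v < step i")
      case True
      then show ?thesis by (rule lookup_dpoly_short[OF _ i])
    next
      case False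
      define w u where "w = take (length v - step i) v" and "u = drop (length v - step i) v"
      have vwu: "v = w @ u" and u: "length u = step i" using False by (auto simp: w_def u_def)
      then show ?thesis using * v i u by (auto simp: vwu lookup_dpoly)
    qed
  qed
  finally show ?thesis .
qed

lemma kclass_in_image_iff:
  assumes g: "\<And>s. g s \<in> polys"
  shows "kclass i g \<in> dmap (i + 1) ` carrier (K (i + 1)) \<longleftrightarrow>
    (\<exists>h. (\<forall>s. h s \<in> polys) \<and> (\<forall>s\<in>degree_words i. \<forall>w. normal_word w \<longrightarrow>
       Poly_Mapping.lookup (g s) w = Poly_Mapping.lookup (dpoly (i + 1) h s) w))"
proof -
  have image: "dmap (i + 1) ` carrier (K (i + 1)) = {kclass i (dpoly (i + 1) h) | h. \<forall>s. h s \<in> polys}"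
    unfolding carrier_K image_image using dmap_kclass[of "i + 1"] by auto
  have eq: "kclass i g = kclass i (dpoly (i + 1) h) \<longleftrightarrow> (\<forall>s\<in>degree_words i. \<forall>w. normal_word w \<longrightarrow>
       Poly_Mapping.lookup (g s) w = Poly_Mapping.lookup (dpoly (i + 1) h s) w)" if h: "\<forall>s. h s \<in> polys" for h
  proof -
    have hp: "\<And>s. dpoly (i + 1) h s \<in> polys" using h by (intro dpoly_polys) blast
    show ?thesis
      using kclass_eq_iff[OF g hp] aclass_eq_iff g hp by (simp add: mem_Collect_eq)
  qed
  show ?thesis unfolding image using eq by blast
qed

text \<open>Exactness at \<open>K\<^sub>i\<close> on basis elements: if \<open>w \<otimes> s\<close> is mapped to \<open>0\<close>, then
  \<open>w = w' v\<close> such that \<open>w \<otimes> s\<close> is the image of the basis element \<open>w' \<otimes> v s\<close> of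
  \<open>K\<^sub>i\<^sub>+\<^sub>1\<close>.\<close>

definition exact_on_words :: "nat \<Rightarrow> bool" where
  "exact_on_words i \<longleftrightarrow> (\<forall>s\<in>degree_words i. \<forall>w.
     normal_word w \<and> \<not> normal_word (w @ take (step i) s) \<longrightarrow>
     (\<exists>w' v. w = w' @ v \<and> length v = step (i + 1) \<and> v @ s \<in> degree_words (i + 1)))"

lemma step_sum: "i > 0 \<Longrightarrow> step (i + 1) + step i = N"
  using length_f by (simp add: step_eq)

text \<open>The degrees of two consecutive differentials add up to \<open>N\<close>, so the word that is moved to the left
  factor by their composition is a factor of length \<open>N\<close> of a word of \<open>W\<close>, that is, \<open>f\<close>. This is why the
  Koszul complex is a complex.\<close>

lemma consecutive_steps:
  assumes "i > 0" "length v = step (i + 1)" "v @ s \<in> degree_words (i + 1)"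
  shows "v @ take (step i) s = f"
proof -
  have s: "s \<in> degree_words i"
    using drop_degree_words[OF _ assms(3)] assms(2) by simp
  have "length (v @ take (step i) s) = N"
    using assms(2) length_degree_words[OF assms(1) s] step_sum[OF assms(1)] by simp
  moreover have "sublist (v @ take (step i) s) (v @ s)"
    by (metis append.assoc append_take_drop_id prefixI prefix_imp_sublist)
  ultimately show ?thesis
    using assms(3) unfolding degree_words_def koszul_words_def by blast
qed

lemma image_subset_kernel:
  assumes i: "i > 0"
  shows "dmap (i + 1) ` carrier (K (i + 1)) \<subseteq> kernel (K i) (K (i - 1)) (dmap i)"
proof
  fix z assume z: "z \<in> dmap (i + 1) ` carrier (K (i + 1))"
  moreover have "z \<in> carrier (K i)"
    using z dmap_hom[of "i + 1"] by (auto simp: hom_def)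
  then obtain g where g: "\<And>s. g s \<in> polys" "z = kclass i g" unfolding carrier_K by blast
  ultimately obtain h where h: "\<And>s w. s \<in> degree_words i \<Longrightarrow> normal_word w \<Longrightarrow>
      Poly_Mapping.lookup (g s) w = Poly_Mapping.lookup (dpoly (i + 1) h s) w"
    using kclass_in_image_iff[where g = g and i = i, OF g(1)] by blast
  have "Poly_Mapping.lookup (g s) w = 0"
    if s: "s \<in> degree_words i" and w: "normal_word (w @ take (step i) s)" for s w
  proof -
    have "normal_word w" using w by (auto simp: normal_word_def sublist_append)
    then have gw: "Poly_Mapping.lookup (g s) w = Poly_Mapping.lookup (dpoly (i + 1) h s) w" by (rule h[OF s])
    show ?thesis
    proof (cases "length w < step (i + 1)")
      case True
      then show ?thesis by (simp add: gw lookup_dpoly_short)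
    next
      case False
      define w' v where "w' = take (length w - step (i + 1)) w" and "v = drop (length w - step (i + 1)) w"
      have wv: "w = w' @ v" and v: "length v = step (i + 1)" using False by (auto simp: w'_def v_def)
      have "v @ s \<notin> degree_words (i + 1)"
      proof
        assume "v @ s \<in> degree_words (i + 1)"
        then have "v @ take (step i) s = f" by (rule consecutive_steps[OF i v])
        then have "sublist f (w @ take (step i) s)" by (simp add: wv sublist_append_leftI)
        then show False using w by (simp add: normal_word_def)
      qed
      then show ?thesis using lookup_dpoly[OF v, of h s w'] gw by (simp add: wv)
    qed
  qed
  then show "z \<in> kernel (K i) (K (i - 1)) (dmap i)"
    using kclass_in_kernel_iff[OF i g(1)] by (simp add: kernel_def g(2))
qed

text \<open>If the condition on words fails at \<open>w\<close> and \<open>s\<close>, then \<open>w \<otimes> s\<close> is a cycle and not a boundary.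
  If it holds, a cycle is lifted by taking off the suffixes \<open>v\<close>.\<close>

lemma kernel_subset_image_iff:
  assumes i: "i > 0"
  shows "kernel (K i) (K (i - 1)) (dmap i) \<subseteq> dmap (i + 1) ` carrier (K (i + 1)) \<longleftrightarrow> exact_on_words i"
proof
  assume sub: "kernel (K i) (K (i - 1)) (dmap i) \<subseteq> dmap (i + 1) ` carrier (K (i + 1))"
  show "exact_on_words i"
    unfolding exact_on_words_def
  proof (intro ballI allI impI)
    fix s w assume s: "s \<in> degree_words i"
      and w: "normal_word w \<and> \<not> normal_word (w @ take (step i) s)"
    define g :: "'v list \<Rightarrow> ('v list \<Rightarrow>\<^sub>0 'k)" where "g s' = (if s' = s then Poly_Mapping.single w 1 else 0)" for s'
    have g: "g s' \<in> polys" for s' using w by (auto simp: g_def normal_word_def)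
    have "dmap i (kclass i g) = \<one>\<^bsub>K (i - 1)\<^esub>"
      unfolding kclass_in_kernel_iff[OF i g] using w by (auto simp: g_def lookup_single when_def)
    then have "kclass i g \<in> dmap (i + 1) ` carrier (K (i + 1))" using sub by (auto simp: kernel_def)
    then obtain h where h: "Poly_Mapping.lookup (g s) w = Poly_Mapping.lookup (dpoly (i + 1) h s) w"
      using kclass_in_image_iff[where g = g and i = i, OF g] s w by blast
    then have nz: "Poly_Mapping.lookup (dpoly (i + 1) h s) w \<noteq> 0" by (simp add: g_def)
    then have "\<not> length w < step (i + 1)" using lookup_dpoly_short[of w "i + 1" h s] by auto
    then have len: "length (drop (length w - step (i + 1)) w) = step (i + 1)" by simp
    show "\<exists>w' v. w = w' @ v \<and> length v = step (i + 1) \<and> v @ s \<in> degree_words (i + 1)"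
    proof (intro exI conjI)
      show "w = take (length w - step (i + 1)) w @ drop (length w - step (i + 1)) w" by simp
      show "drop (length w - step (i + 1)) w @ s \<in> degree_words (i + 1)"
        using lookup_dpoly[OF len, of h s "take (length w - step (i + 1)) w"] nz by (auto split: if_splits)
    qed (rule len)
  qed
next
  assume ex: "exact_on_words i"
  show "kernel (K i) (K (i - 1)) (dmap i) \<subseteq> dmap (i + 1) ` carrier (K (i + 1))"
  proof
    fix z assume "z \<in> kernel (K i) (K (i - 1)) (dmap i)"
    then obtain g where g: "\<And>s. g s \<in> polys" "z = kclass i g" and ker: "dmap i (kclass i g) = \<one>\<^bsub>K (i - 1)\<^esub>"
      unfolding kernel_def carrier_K by blast
    \<comment> \<open>The lift: each term \<open>w' v \<otimes> s\<close> of the cycle is replaced by \<open>w' \<otimes> v s\<close>. The value \<open>0\<close> only keeps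
    the coefficients of \<open>h\<close> supported on words over \<open>B\<close>.\<close>
    define h where "h t = (if t \<in> lists B then right_quotient (take (step (i + 1)) t) (g (drop (step (i + 1)) t)) else 0)" for t
    have h: "h t \<in> polys" for t
    proof -
      have "w \<in> lists B" if "w @ u \<in> Poly_Mapping.keys (g s)" for w u s
        using that g(1)[of s] by auto
      then show ?thesis by (simp add: h_def in_keys_iff lookup_right_quotient subset_iff del: in_lists_conv_set)
    qed
    have "Poly_Mapping.lookup (g s) w = Poly_Mapping.lookup (dpoly (i + 1) h s) w"
      if s: "s \<in> degree_words i" and w: "normal_word w" for s w
    proof (cases "\<exists>w' v. w = w' @ v \<and> length v = step (i + 1) \<and> v @ s \<in> degree_words (i + 1)")
      case True
      then obtain w' v where wv: "w = w' @ v" "length v = step (i + 1)" "v @ s \<in> degree_words (i + 1)" by blast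
      then have "v @ s \<in> lists B" by (intro degree_word)
      then show ?thesis using wv by (simp add: lookup_dpoly h_def lookup_right_quotient)
    next
      case False
      then have "normal_word (w @ take (step i) s)" using ex s w unfolding exact_on_words_def by blast
      then have "Poly_Mapping.lookup (g s) w = 0" using ker s unfolding kclass_in_kernel_iff[OF i g(1)] by blast
      moreover have "Poly_Mapping.lookup (dpoly (i + 1) h s) w = 0"
      proof (cases "length w < step (i + 1)")
        case True
        then show ?thesis by (simp add: lookup_dpoly_short)
      next
        case len: False
        define w' v where "w' = take (length w - step (i + 1)) w" and "v = drop (length w - step (i + 1)) w"
        have "w = w' @ v" "length v = step (i + 1)" using len by (auto simp: w'_def v_def)
        with False show ?thesis by (auto simp: lookup_dpoly)
      qed
      ultimately show ?thesis by simp
    qed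
    then show "z \<in> dmap (i + 1) ` carrier (K (i + 1))"
      unfolding g(2) kclass_in_image_iff[where g = g and i = i, OF g(1)] using h by blast
  qed
qed

lemma trivial_homology_iff:
  assumes i: "i > 0"
  shows "trivial_group (koszul_homology scale N R i) \<longleftrightarrow> exact_on_words i"
proof -
  let ?Ker = "kernel (K i) (K (i - 1)) (dmap i)" and ?Im = "dmap (i + 1) ` carrier (K (i + 1))"
  interpret K: comm_group "K i" by (rule comm_group_K)
  interpret d: group_hom "K i" "K (i - 1)" "dmap i"
    using dmap_hom[OF i] comm_group_K by (intro group_hom.intro group_hom_axioms.intro) (auto simp: comm_group_def)
  interpret d': group_hom "K (i + 1)" "K i" "dmap (i + 1)"
    using dmap_hom[of "i + 1"] comm_group_K
    by (intro group_hom.intro group_hom_axioms.intro) (auto simp: comm_group_def)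
  have comm: "comm_group ((K i)\<lparr>carrier := ?Ker\<rparr>)"
    by (rule group.group_comm_groupI[OF K.subgroup_imp_group[OF d.subgroup_kernel]])
       (auto simp: kernel_def K.m_comm)
  have "trivial_group (koszul_homology scale N R i) \<longleftrightarrow> trivial_group ((K i)\<lparr>carrier := ?Ker\<rparr> Mod ?Im)"
    using koszul_diff_dmap[OF i] koszul_diff_dmap[of "i + 1"] by (simp add: koszul_homology_def)
  also have "\<dots> \<longleftrightarrow> ?Im = ?Ker"
    using trivial_quotient_iff[OF comm
        K.subgroup_incl[OF d'.img_is_subgroup d.subgroup_kernel image_subset_kernel[OF i]]]
    by simp
  also have "\<dots> \<longleftrightarrow> exact_on_words i"
    using image_subset_kernel[OF i] kernel_subset_image_iff[OF i] by blast
  finally show ?thesis .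
qed

lemma N_koszul_iff_exact_on_words: "N_koszul scale N R \<longleftrightarrow> (\<forall>i>0. exact_on_words i)"
  unfolding N_koszul_def using trivial_homology_iff by blast

section \<open>The Koszul property in terms of borders\<close>

lemma degree_words_1: "degree_words 1 = words 1"
  using length_f by (auto simp: degree_words_def jump_def koszul_words_def words_def dest!: sublist_length_le)

text \<open>A factor \<open>f\<close> that appears when a normal word is extended must reach into the extension.\<close>

lemma sublist_f_split:
  assumes "normal_word w" "v \<in> lists B" "\<not> normal_word (w @ v)"
  obtains ps ss where "w @ v = ps @ f @ ss" "length ss < length v"
proof -
  have "sublist f (w @ v)" using assms by (auto simp: normal_word_def)
  then obtain ps ss where ps: "w @ v = ps @ f @ ss" by (auto simp: sublist_def)
  have "length ss < length v"
  proof (rule ccontr)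
    assume "\<not> length ss < length v"
    moreover have "length w + length v = length ps + N + length ss"
      using ps by (metis add.assoc length_append)
    ultimately have "w = ps @ f @ take (length w - (length ps + N)) ss"
      using arg_cong[OF ps, of "take (length w)"] by simp
    then show False using assms(1) unfolding normal_word_def sublist_def by blast
  qed
  with ps that show thesis by blast
qed

lemma f_in_koszul_words: "f \<in> koszul_words N"
  using f_word by (auto simp: koszul_words_def words_def sublist_def)

lemma koszul_words_length_f: "koszul_words N = {f}"
  using f_in_koszul_words by (auto simp: koszul_words_def words_def)

text \<open>A normal word that ceases to be normal after one more letter is \<open>f\<close> without its last letter, preceded by
  some word.\<close>

lemma exact_on_words_1: "exact_on_words 1"
  unfolding exact_on_words_def
proof (intro ballI allI impI)
  fix s w assume s: "s \<in> degree_words 1" and w: "normal_word w \<and> \<not> normal_word (w @ take (step 1) s)"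
  have "step 1 = 1" and step2: "step (1 + 1) = N - 1" by (simp_all add: step_eq)
  obtain b where b: "s = [b]" "b \<in> B"
    using s unfolding degree_words_1 by (auto simp: words_def length_Suc_conv)
  with \<open>step 1 = 1\<close> obtain ps ss where "w @ [b] = ps @ f @ ss" "length ss < length [b]"
    using sublist_f_split[of w "[b]"] w by auto
  then have wb: "w @ [b] = ps @ f" by simp
  have f_snoc: "butlast f @ [last f] = f"
    using length_f by (intro append_butlast_last_id) auto
  have "w @ [b] = (ps @ butlast f) @ [last f]" using wb f_snoc by simp
  then have wb: "w = ps @ butlast f" "b = last f" by simp_all
  have degree_2: "degree_words (1 + 1) = {f}"
    by (simp add: degree_words_def jump_def koszul_words_length_f)
  show "\<exists>w' v. w = w' @ v \<and> length v = step (1 + 1) \<and> v @ s \<in> degree_words (1 + 1)"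
  proof (intro exI conjI)
    show "w = ps @ butlast f" by (rule wb(1))
    show "length (butlast f) = step (1 + 1)" unfolding step2 by simp
    show "butlast f @ s \<in> degree_words (1 + 1)" unfolding degree_2 b(1) wb(2) f_snoc by simp
  qed
qed

lemma jump_ge: "i \<ge> 2 \<Longrightarrow> jump N i \<ge> N"
proof -
  assume "i \<ge> 2"
  then have "N * 1 \<le> N * (i div 2)" using div_le_mono[of 2 i 2] by (intro mult_le_mono2) simp
  moreover have "N * (i div 2) \<le> jump N i" by (simp add: jump_def)
  ultimately show ?thesis by (metis mult_1_right order.trans)
qed

text \<open>Every letter of a word of length at least \<open>N\<close> lies in some factor of length \<open>N\<close>.\<close>

lemma koszul_words_constant:
  assumes f: "set f \<subseteq> {b}" and m: "N \<le> m"
  shows "koszul_words m = {replicate m b}"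
proof
  have fr: "f = replicate N b" using f constant_iff by metis
  show "koszul_words m \<subseteq> {replicate m b}"
  proof
    fix w assume w: "w \<in> koszul_words m"
    then have len: "length w = m" by (simp add: koszul_words_def words_def)
    have "c = b" if c: "c \<in> set w" for c
    proof -
      obtain k where k: "k < m" "w ! k = c" using c len by (auto simp: in_set_conv_nth)
      \<comment> \<open>The window starts at \<open>k\<close> unless it would run over the end of \<open>w\<close>.\<close>
      define j where "j = min k (m - N)"
      have factor: "take N (drop j w) = f"
        using w len m sublist_order.order.trans[OF sublist_take sublist_drop, of N j w]
        unfolding koszul_words_def j_def by auto
      have jk: "j \<le> k" "k - j < N" using k m length_f by (auto simp: j_def min_def)
      then have "take N (drop j w) ! (k - j) = c" using k len by simp
      then have "f ! (k - j) = c" by (simp only: factor)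
      then have "c \<in> set f" using nth_mem[OF jk(2)] by simp
      then show ?thesis using f by blast
    qed
    then have "set w \<subseteq> {b}" by blast
    then show "w \<in> {replicate m b}" using constant_iff[of w b] len by simp
  qed
  have "b \<in> B" using f_word fr length_f by (cases N) auto
  moreover have "t = f" if t: "sublist t (replicate m b)" "length t = N" for t
  proof -
    have "set t \<subseteq> {b}" using set_mono_sublist[OF t(1)] by (auto split: if_splits)
    then show ?thesis using fr t(2) constant_iff[of t b] by simp
  qed
  ultimately show "{replicate m b} \<subseteq> koszul_words m"
    by (auto simp: koszul_words_def words_def)
qed

text \<open>A factor \<open>f = b\<^sup>N\<close> that reaches into the appended power of \<open>b\<close> leaves behind a power of \<open>b\<close> at the
  end of \<open>w\<close>, which is at least as long as the step of the next differential.\<close>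

lemma exact_on_words_constant:
  assumes f: "set f \<subseteq> {b}" and i: "i \<ge> 2"
  shows "exact_on_words i"
  unfolding exact_on_words_def
proof (intro ballI allI impI)
  fix s w assume s: "s \<in> degree_words i" and w: "normal_word w \<and> \<not> normal_word (w @ take (step i) s)"
  let ?e = "step i" and ?e' = "step (i + 1)"
  have fr: "f = replicate N b" using f constant_iff by metis
  have e: "?e' + ?e = N" "jump N i = ?e + jump N (i - 1)" "jump N (i + 1) = ?e' + jump N i"
    using step_sum[of i] jump_step[of i] jump_step[of "i + 1"] i by auto
  have sr: "s = replicate (jump N i) b"
    using s koszul_words_constant[OF f jump_ge[OF i]] by (simp add: degree_words_def)
  then have take: "take ?e s = replicate ?e b" using e by (simp add: min_def)
  have "take ?e s \<in> lists B" using s degree_word take_word by blast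
  then obtain ps ss where ps: "w @ replicate ?e b = ps @ f @ ss" "length ss < ?e"
    using sublist_f_split[of w "take ?e s"] w take by (metis length_replicate)
  have "suffix ss (replicate ?e b)"
    using ps by (metis append_assoc nless_le length_replicate suffixI suffix_length_suffix)
  then have "set ss \<subseteq> {b}" using set_mono_suffix by (fastforce split: if_splits)
  then have "ss = replicate (length ss) b" using constant_iff[of ss b] by simp
  then have "f @ ss = replicate (N + length ss) b" using fr by (metis replicate_add)
  also have "N + length ss = (length ss + ?e') + ?e" using e(1) by simp
  finally have "w @ replicate ?e b = (ps @ replicate (length ss + ?e') b) @ replicate ?e b"
    using ps(1) by (simp add: replicate_add)
  then have "w = (ps @ replicate (length ss) b) @ replicate ?e' b" by (simp add: replicate_add)
  moreover have "replicate ?e' b @ s \<in> degree_words (i + 1)"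
    using koszul_words_constant[OF f jump_ge, of "i + 1"] i e(3)
    by (simp add: degree_words_def sr replicate_add)
  ultimately show "\<exists>w' v. w = w' @ v \<and> length v = ?e' \<and> v @ s \<in> degree_words (i + 1)"
    by (metis length_replicate)
qed

text \<open>If two factors of length \<open>N\<close> at distance \<open>1\<close> are both \<open>f\<close>, then every letter of \<open>f\<close> equals the
  next one.\<close>

lemma koszul_words_nonconstant:
  assumes f: "\<not> (\<exists>b. set f \<subseteq> {b})" and m: "N < m"
  shows "koszul_words m = {}"
proof (rule ccontr)
  assume "koszul_words m \<noteq> {}"
  then obtain w where w: "w \<in> koszul_words m" by blast
  then have len: "length w = m" by (simp add: koszul_words_def words_def)
  have f0: "take N w = f"
    using w len m sublist_take[of N w] unfolding koszul_words_def by auto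
  have f1: "take N (drop 1 w) = f"
    using w len m sublist_order.order.trans[OF sublist_take sublist_drop, of N 1 w]
    unfolding koszul_words_def by auto
  have const: "f ! k = f ! 0" if "k < N" for k
    using that
  proof (induction k)
    case (Suc k)
    have "f ! Suc k = w ! Suc k" using f0 Suc.prems by (metis nth_take)
    also have "\<dots> = take N (drop 1 w) ! k" using Suc.prems len m by simp
    also have "\<dots> = f ! k" by (simp only: f1)
    finally show ?case using Suc by simp
  qed simp
  then have "set f \<subseteq> {f ! 0}" by (auto simp: in_set_conv_nth)
  then show False using f by blast
qed

lemma degree_words_nonconstant:
  assumes "\<not> (\<exists>b. set f \<subseteq> {b})" "i \<ge> 3"
  shows "degree_words i = {}"
proof -
  have "N < jump N i"
  proof (cases "even i")
    case True
    then have "i div 2 \<ge> 2" using assms(2) by auto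
    then have "N * 2 \<le> N * (i div 2)" by (rule mult_le_mono2)
    moreover have "jump N i = N * (i div 2)" using True by (simp add: jump_def)
    ultimately show ?thesis using length_f by linarith
  next
    case False
    have "N * 1 \<le> N * (i div 2)" using assms(2) by (intro mult_le_mono2) linarith
    moreover have "jump N i = N * (i div 2) + 1" using False by (simp add: jump_def)
    ultimately show ?thesis by linarith
  qed
  then show ?thesis
    using koszul_words_nonconstant[OF assms(1)] by (simp add: degree_words_def)
qed

text \<open>Since \<open>K\<^sub>3 = 0\<close>, exactness at \<open>K\<^sub>2 = A \<otimes> f\<close> means that appending \<open>f\<close> without its last
  letter preserves normality. A factor \<open>f\<close> of the result starts inside \<open>w\<close> and ends inside the appended
  prefix of \<open>f\<close>, and the overlap is a border. Conversely, if \<open>p\<close> is the length of a border, then the first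
  \<open>N - p\<close> letters of \<open>f\<close> form a normal word that is completed to \<open>f\<close> by what is appended.\<close>

lemma exact_on_words_2_iff:
  assumes f: "\<not> (\<exists>b. set f \<subseteq> {b})"
  shows "exact_on_words 2 \<longleftrightarrow> \<not> (\<exists>p. has_border f p)"
proof -
  have dw: "degree_words 2 = {f}" "degree_words 3 = {}" "step 2 = N - 1"
    using degree_words_nonconstant[OF f, of 3]
    by (simp_all add: degree_words_def jump_def koszul_words_length_f step_eq)
  have "exact_on_words 2 \<longleftrightarrow> (\<forall>w. normal_word w \<longrightarrow> normal_word (w @ take (N - 1) f))"
    by (auto simp: exact_on_words_def dw)
  also have "\<dots> \<longleftrightarrow> \<not> (\<exists>p. has_border f p)"
  proof
    assume normal: "\<forall>w. normal_word w \<longrightarrow> normal_word (w @ take (N - 1) f)"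
    show "\<not> (\<exists>p. has_border f p)"
    proof
      assume "\<exists>p. has_border f p"
      then obtain p where p: "0 < p" "p < N" "take p f = drop (N - p) f" by (auto simp: has_border_def)
      have "length (take (N - p) f) < N" using p(1,2) by simp
      then have "\<not> sublist f (take (N - p) f)" using sublist_length_le not_le by blast
      then have normal_take: "normal_word (take (N - p) f)"
        using take_word[OF f_word] by (simp only: normal_word_def simp_thms)
      have "min p (N - 1) = p" using p(1,2) by simp
      then have "take p (take (N - 1) f) = take p f" by (simp only: take_take)
      then have "take (N - 1) f = take p f @ drop p (take (N - 1) f)"
        using append_take_drop_id[of p "take (N - 1) f"] by simp
      then have "take (N - p) f @ take (N - 1) f = f @ drop p (take (N - 1) f)"
        using p(3) by (metis append.assoc append_take_drop_id)
      then have "sublist f (take (N - p) f @ take (N - 1) f)" by simp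
      moreover have "normal_word (take (N - p) f @ take (N - 1) f)"
        using normal normal_take by blast
      ultimately show False by (simp add: normal_word_def)
    qed
  next
    assume border: "\<not> (\<exists>p. has_border f p)"
    show "\<forall>w. normal_word w \<longrightarrow> normal_word (w @ take (N - 1) f)"
    proof (intro allI impI, rule ccontr)
      fix w assume w: "normal_word w" "\<not> normal_word (w @ take (N - 1) f)"
      obtain ps ss where ps: "w @ take (N - 1) f = ps @ f @ ss" "length ss < N - 1"
        using sublist_f_split[OF w(1) take_word[OF f_word] w(2)] by auto
      \<comment> \<open>The length of the part of the factor \<open>f\<close> that lies in the appended prefix.\<close>
      define p where "p = N - 1 - length ss"
      have len: "length w = length ps + (N - p)"
        using arg_cong[OF ps(1), of length] ps(2) by (simp add: p_def)
      have pN: "0 < p" "p < N" using ps(2) length_f by (auto simp: p_def)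
      have "take (N - 1) f = drop (N - p) f @ ss"
        using arg_cong[OF ps(1), of "drop (length w)"] len by simp
      then have "take p (take (N - 1) f) = drop (N - p) f"
        using pN by simp
      moreover have "min p (N - 1) = p" using pN by simp
      ultimately have "take p f = drop (N - p) f" by (simp only: take_take)
      then show False using border pN by (auto simp: has_border_def)
    qed
  qed
  finally show ?thesis .
qed

theorem N_koszul_iff:
  "N_koszul scale N R \<longleftrightarrow> (\<exists>b. set f \<subseteq> {b}) \<or> \<not> (\<exists>p. has_border f p)"
proof (cases "\<exists>b. set f \<subseteq> {b}")
  case True
  then obtain b where "set f \<subseteq> {b}" ..
  then have "exact_on_words i" if "i > 0" for i
    using exact_on_words_1 exact_on_words_constant that by (cases "i = 1") auto
  with True show ?thesis by (simp add: N_koszul_iff_exact_on_words)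
next
  case False
  have "exact_on_words i" if "i \<ge> 3" for i
    using degree_words_nonconstant[OF False that] by (simp add: exact_on_words_def)
  moreover have "i = 1 \<or> i = 2 \<or> i \<ge> 3" if "i > 0" for i :: nat using that by auto
  ultimately have "(\<forall>i>0. exact_on_words i) \<longleftrightarrow> exact_on_words 2"
    using exact_on_words_1 by (metis zero_less_numeral)
  with False show ?thesis by (simp add: N_koszul_iff_exact_on_words exact_on_words_2_iff)
qed

lemma tclass_word_power:
  "tclass (Poly_Mapping.single u 1) [^]\<^bsub>T\<^esub> (q::nat) = tclass (Poly_Mapping.single (concat (replicate q u)) 1)"
proof (induction q)
  case 0
  have "(1 :: 'v list \<Rightarrow>\<^sub>0 'k) = Poly_Mapping.single [] 1"
    by (simp flip: zero_list_def)
  then show ?case by (simp add: tclass_one)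
next
  case (Suc q)
  have "concat (replicate q u) @ u = concat (replicate (Suc q) u)"
    by (simp flip: replicate_append_same)
  with Suc show ?case by (simp add: tclass_mult single_mult_single del: replicate_Suc)
qed

end

theorem corollary1p3:
  fixes scale :: "'k::field \<Rightarrow> 'v::ab_group_add \<Rightarrow> 'v"
    and x :: "nat \<Rightarrow> 'v" and i :: "nat \<Rightarrow> nat" and n N :: nat
    and f :: "('v list \<Rightarrow>\<^sub>0 'k) set" and R :: "('v list \<Rightarrow>\<^sub>0 'k) set set"
  assumes "vector_space scale"
    and "n \<ge> 1"
    and "inj_on x {1..n}"
    and "\<not> module.dependent scale (x ` {1..n})"
    and "module.span scale (x ` {1..n}) = UNIV"
    and "N \<ge> 2"
    and "\<forall>j\<in>{1..N}. i j \<in> {1..n}"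
    and "f = monomial scale x i N"
    and "R = lin_span (tensor_algebra scale) {f}"
  shows "N_koszul scale N R \<longleftrightarrow>
    \<not> (\<exists>m\<in>{2..N - 1}.
         f = (monomial scale x i m [^]\<^bsub>tensor_algebra scale\<^esub> (N div m))
               \<otimes>\<^bsub>tensor_algebra scale\<^esub> monomial scale x i (N mod m) \<and>
         \<not> (\<forall>j\<in>{1..m}. \<forall>l\<in>{1..m}. i j = i l))"
proof -
  define B where "B = x ` {1..n}"
  define w where "w m = map (\<lambda>j. x (i j)) [1..<m + 1]" for m
  have w_basis: "w m \<in> lists B" if "m \<le> N" for m
    using assms(7) that by (auto simp: w_def B_def)
  have len: "length (w m) = m" for m by (simp add: w_def)
  have take_w: "take m (w N) = w m" if "m \<le> N" for m
    using that by (simp add: w_def take_map take_upt del: upt_Suc)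
  interpret vector_space scale by fact
  interpret M: monomial_relation scale B "w N"
    by unfold_locales (use assms w_basis[of N] len in \<open>auto simp: B_def\<close>)
  have mono: "monomial scale x i m = M.tclass (Poly_Mapping.single (w m) 1)" for m
    by (simp add: monomial_def w_def M.pure_tensor_eq)
  have R: "R = M.word_span {w N}"
    unfolding assms(8,9) mono by (rule M.lin_span_eq_word_span) (auto intro: M.tclass_in_word_span)
  have power_eq: "f = (monomial scale x i m [^]\<^bsub>tensor_algebra scale\<^esub> (N div m))
        \<otimes>\<^bsub>tensor_algebra scale\<^esub> monomial scale x i (N mod m) \<longleftrightarrow>
      w N = concat (replicate (N div m) (take m (w N))) @ take (N mod m) (w N)"
    if m: "m \<in> {2..N - 1}" for m
  proof -
    have "N mod m \<le> N" by (rule mod_less_eq_dividend)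
    have "m \<le> N" using m by auto
    have "concat (replicate (N div m) (w m)) @ w (N mod m) \<in> lists B"
      using w_basis[OF \<open>m \<le> N\<close>] w_basis[OF \<open>N mod m \<le> N\<close>] by auto
    then have "M.tclass (Poly_Mapping.single (w N) 1) =
        M.tclass (Poly_Mapping.single (concat (replicate (N div m) (w m)) @ w (N mod m)) 1) \<longleftrightarrow>
        Poly_Mapping.single (w N) (1::'k) = Poly_Mapping.single (concat (replicate (N div m) (w m)) @ w (N mod m)) 1"
      using w_basis[of N] by (intro M.tclass_inject) simp_all
    also have "\<dots> \<longleftrightarrow> w N = concat (replicate (N div m) (w m)) @ w (N mod m)"
      by (metis keys_single singleton_inject zero_neq_one)
    finally show ?thesis
      using take_w[OF \<open>m \<le> N\<close>] take_w[OF \<open>N mod m \<le> N\<close>]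
      by (simp add: assms(8) mono M.tclass_word_power M.tclass_mult single_mult_single)
  qed
  have const: "(\<forall>j\<in>{1..m}. \<forall>l\<in>{1..m}. i j = i l) \<longleftrightarrow> (\<exists>b. set (take m (w N)) \<subseteq> {b})" if m: "m \<le> N" for m
  proof -
    have set: "set (take m (w N)) = (\<lambda>j. x (i j)) ` {1..m}"
      unfolding take_w[OF m] by (auto simp: w_def)
    have eq: "i j = i l \<longleftrightarrow> x (i j) = x (i l)" if "j \<in> {1..m}" "l \<in> {1..m}" for j l
    proof -
      have "j \<in> {1..N}" "l \<in> {1..N}" using that m by simp_all
      then have "i j \<in> {1..n}" "i l \<in> {1..n}" using assms(7) by blast+
      then show ?thesis using inj_on_eq_iff[OF assms(3)] by metis
    qed
    show ?thesis
    proof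
      assume const: "\<forall>j\<in>{1..m}. \<forall>l\<in>{1..m}. i j = i l"
      have "x (i j) \<in> {x (i 1)}" if j: "j \<in> {1..m}" for j
      proof -
        have "1 \<in> {1..m}" using j by simp
        with const j have "i j = i 1" by blast
        then show ?thesis by simp
      qed
      then have "set (take m (w N)) \<subseteq> {x (i 1)}" unfolding set by (rule image_subsetI)
      then show "\<exists>b. set (take m (w N)) \<subseteq> {b}" ..
    next
      assume "\<exists>b. set (take m (w N)) \<subseteq> {b}"
      then obtain b where "\<And>j. j \<in> {1..m} \<Longrightarrow> x (i j) = b" unfolding set by blast
      then show "\<forall>j\<in>{1..m}. \<forall>l\<in>{1..m}. i j = i l" by (simp add: eq)
    qed
  qed
  let ?P = "\<lambda>m. w N = concat (replicate (N div m) (take m (w N))) @ take (N mod m) (w N)"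
  have "N_koszul scale N R \<longleftrightarrow> (\<exists>b. set (w N) \<subseteq> {b}) \<or> \<not> (\<exists>p. has_border (w N) p)"
    using M.N_koszul_iff by (simp add: R len)
  also have "\<dots> \<longleftrightarrow> \<not> (\<exists>m\<in>{2..N - 1}. ?P m \<and> \<not> (\<exists>b. set (take m (w N)) \<subseteq> {b}))"
  proof (cases "\<exists>b. set (w N) \<subseteq> {b}")
    case True
    then show ?thesis using set_take_subset by (metis order.trans)
  next
    case False
    then show ?thesis using border_iff_period[OF False] by (simp add: len)
  qed
  also have "\<dots> \<longleftrightarrow> \<not> (\<exists>m\<in>{2..N - 1}.
         f = (monomial scale x i m [^]\<^bsub>tensor_algebra scale\<^esub> (N div m))
               \<otimes>\<^bsub>tensor_algebra scale\<^esub> monomial scale x i (N mod m) \<and>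
         \<not> (\<forall>j\<in>{1..m}. \<forall>l\<in>{1..m}. i j = i l))"
  proof (intro arg_cong[where f = Not] bex_cong refl)
    fix m assume m: "m \<in> {2..N - 1}"
    then have "m \<le> N" by auto
    then show "?P m \<and> \<not> (\<exists>b. set (take m (w N)) \<subseteq> {b}) \<longleftrightarrow>
        f = (monomial scale x i m [^]\<^bsub>tensor_algebra scale\<^esub> (N div m))
          \<otimes>\<^bsub>tensor_algebra scale\<^esub> monomial scale x i (N mod m) \<and>
        \<not> (\<forall>j\<in>{1..m}. \<forall>l\<in>{1..m}. i j = i l)"
      using power_eq[OF m] const by blast
  qed
  finally show ?thesis .
qed

end
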